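(* Let $\mathsf{J}\mathbb{N}=(\mathbb{N}^\mathbb{N}\to\mathbb{N})\times(\mathbb{N}^\mathbb{N}\to\mathbb{N})$, writing $\mathrm{V}_w$ and $\mathrm{M}_w$ for the first and second components of $w:\mathsf{J}\mathbb{N}$. Define \[ \eta(n):=\langle\lambda\alpha.n,\ \lambda\alpha.0\rangle,\qquad \kappa(g,w):=\big\langle\lambda\alpha.\mathrm{V}_{g(\mathrm{V}_w(\alpha))}(\alpha),\ \lambda\alpha.\max(\mathrm{M}_{g(\mathrm{V}_w(\alpha))}(\alpha),\mathrm{M}_w(\alpha))\big\rangle, \] and $\Omega:\mathsf{J}\mathbb{N}\to\mathsf{J}\mathbb{N}$ by $\Omega:=\kappa(\lambda n.\langle\lambda\alpha.\alpha n,\ \lambda\alpha.n+1\rangle)$. Then for every closed term $f:\mathbb{N}^\mathbb{N}\to\mathbb{N}$ of $\mathsf{T}$ (extended with products), the function $M:=\mathrm{M}_{f^\mathsf{J}(\Omega)}:\mathbb{N}^\mathbb{N}\to\mathbb{N}$ is a modulus of continuity of $f$, i.e. \[ \forall\alpha^{\mathbb{N}^\mathbb{N}}\beta^{\mathbb{N}^\mathbb{N}}\big(\alpha=_{M\alpha}\beta\to f\alpha=f\beta\big), \] where $\alpha=_m\beta$ means $\forall i<m\,(\alpha i=\beta i)$.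
   Context: System $\mathsf{T}$ extended with products: types $\mathbb{N}$, $\sigma\to\tau$, $\sigma\times\tau$; terms: variables, $\lambda$-abstraction, application, $0$, $\mathsf{suc}$, $\mathsf{rec}_\sigma:\sigma\to(\mathbb{N}\to\sigma\to\sigma)\to\mathbb{N}\to\sigma$ (with $\mathsf{rec}(a,f,0)=a$, $\mathsf{rec}(a,f,n+1)=f(n,\mathsf{rec}(a,f,n))$), and $\mathsf{pair}:\sigma\to\tau\to\sigma\times\tau$ (written $\langle a,b\rangle$), $\mathsf{pr}_1,\mathsf{pr}_2$ with the usual computation rules. $\mathbb{N}^\mathbb{N}$ denotes $\mathbb{N}\to\mathbb{N}$; $\max$ is definable in $\mathsf{T}$. Terms are interpreted as functionals of finite type. The $\mathsf{J}$-translation for a nucleus $(\mathsf{J}\mathbb{N},\eta,\kappa)$ (a type $\mathsf{J}\mathbb{N}$ and terms $\eta:\mathbb{N}\to\mathsf{J}\mathbb{N}$, $\kappa:(\mathbb{N}\to\mathsf{J}\mathbb{N})\to\mathsf{J}\mathbb{N}\to\mathsf{J}\mathbb{N}$): on types $\mathbb{N}^\mathsf{J}:=\mathsf{J}\mathbb{N}$, $(\sigma\to\tau)^\mathsf{J}:=\sigma^\mathsf{J}\to\tau^\mathsf{J}$, $(\sigma\times\tau)^\mathsf{J}:=\sigma^\mathsf{J}\times\tau^\mathsf{J}$; on terms, variables $x:\sigma$ go to fresh $x^\mathsf{J}:\sigma^\mathsf{J}$, $(\lambda x.t)^\mathsf{J}:=\lambda x^\mathsf{J}.t^\mathsf{J}$,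 $(tu)^\mathsf{J}:=t^\mathsf{J}u^\mathsf{J}$, $0^\mathsf{J}:=\eta\,0$, $\mathsf{suc}^\mathsf{J}:=\kappa(\eta\circ\mathsf{suc})$, $\mathsf{pair},\mathsf{pr}_1,\mathsf{pr}_2$ translate to themselves at the translated types, and $(\mathsf{rec}_\sigma)^\mathsf{J}:=\lambda x^{\sigma^\mathsf{J}}f^{\mathsf{J}\mathbb{N}\to\sigma^\mathsf{J}\to\sigma^\mathsf{J}}.\,\mathrm{ke}_\sigma(\mathsf{rec}_{\sigma^\mathsf{J}}(x,f\circ\eta))$, where $\mathrm{ke}_\sigma:(\mathbb{N}\to\sigma^\mathsf{J})\to\mathsf{J}\mathbb{N}\to\sigma^\mathsf{J}$ is given by $\mathrm{ke}_\mathbb{N}:=\kappa$, $\mathrm{ke}_{\sigma\to\tau}:=\lambda g\,a\,x.\,\mathrm{ke}_\tau(\lambda n.g(n,x),a)$, $\mathrm{ke}_{\sigma\times\tau}:=\lambda g\,a.\,\langle\mathrm{ke}_\sigma(\mathsf{pr}_1\circ g,a),\mathrm{ke}_\tau(\mathsf{pr}_2\circ g,a)\rangle$. In particular $f^\mathsf{J}:(\mathsf{J}\mathbb{N}\to\mathsf{J}\mathbb{N})\to\mathsf{J}\mathbb{N}$ for $f:\mathbb{N}^\mathbb{N}\to\mathbb{N}$. *)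

theory Defs
  imports Main "HOL-Library.FuncSet"
begin

section \<open>System T with products\<close>

datatype ty =
    NatT
  | Arrow ty ty  (infixr "\<Rrightarrow>" 65)
  | Times ty ty  (infixr "\<otimes>" 70)

text \<open>
  Terms in Church style: a variable is a name together with its type, and
  variables with the same name but different types are different variables.
\<close>

datatype tm =
    Var string ty
  | Lam string ty tm
  | App tm tm  (infixl "\<cdot>" 200)
  | Zero
  | Succ
  | Rec ty
  | Mkpair ty ty
  | Pr1 ty ty
  | Pr2 ty ty

primrec type_of :: "tm \<Rightarrow> ty option" where
  "type_of (Var x \<sigma>) = Some \<sigma>"
| "type_of (Lam x \<sigma> t) = map_option (\<lambda>\<tau>. \<sigma> \<Rrightarrow> \<tau>) (type_of t)"
| "type_of (t \<cdot> u) =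
    (case type_of t of
       Some (\<sigma> \<Rrightarrow> \<tau>) \<Rightarrow> if type_of u = Some \<sigma> then Some \<tau> else None
     | _ \<Rightarrow> None)"
| "type_of Zero = Some NatT"
| "type_of Succ = Some (NatT \<Rrightarrow> NatT)"
| "type_of (Rec \<sigma>) = Some (\<sigma> \<Rrightarrow> (NatT \<Rrightarrow> \<sigma> \<Rrightarrow> \<sigma>) \<Rrightarrow> NatT \<Rrightarrow> \<sigma>)"
| "type_of (Mkpair \<sigma> \<tau>) = Some (\<sigma> \<Rrightarrow> \<tau> \<Rrightarrow> \<sigma> \<otimes> \<tau>)"
| "type_of (Pr1 \<sigma> \<tau>) = Some (\<sigma> \<otimes> \<tau> \<Rrightarrow> \<sigma>)"
| "type_of (Pr2 \<sigma> \<tau>) = Some (\<sigma> \<otimes> \<tau> \<Rrightarrow> \<tau>)"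

primrec free_vars :: "tm \<Rightarrow> (string \<times> ty) set" where
  "free_vars (Var x \<sigma>) = {(x, \<sigma>)}"
| "free_vars (Lam x \<sigma> t) = free_vars t - {(x, \<sigma>)}"
| "free_vars (t \<cdot> u) = free_vars t \<union> free_vars u"
| "free_vars Zero = {}"
| "free_vars Succ = {}"
| "free_vars (Rec \<sigma>) = {}"
| "free_vars (Mkpair \<sigma> \<tau>) = {}"
| "free_vars (Pr1 \<sigma> \<tau>) = {}"
| "free_vars (Pr2 \<sigma> \<tau>) = {}"

definition closed_tm :: "tm \<Rightarrow> bool" where
  "closed_tm t \<longleftrightarrow> free_vars t = {}"

primrec subterms :: "tm \<Rightarrow> tm set" where
  "subterms (Var x \<sigma>) = {Var x \<sigma>}"
| "subterms (Lam x \<sigma> t) = insert (Lam x \<sigma> t) (subterms t)"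
| "subterms (t \<cdot> u) = insert (t \<cdot> u) (subterms t \<union> subterms u)"
| "subterms Zero = {Zero}"
| "subterms Succ = {Succ}"
| "subterms (Rec \<sigma>) = {Rec \<sigma>}"
| "subterms (Mkpair \<sigma> \<tau>) = {Mkpair \<sigma> \<tau>}"
| "subterms (Pr1 \<sigma> \<tau>) = {Pr1 \<sigma> \<tau>}"
| "subterms (Pr2 \<sigma> \<tau>) = {Pr2 \<sigma> \<tau>}"

primrec rank :: "ty \<Rightarrow> nat" where
  "rank NatT = 0"
| "rank (\<sigma> \<Rrightarrow> \<tau>) = Suc (max (rank \<sigma>) (rank \<tau>))"
| "rank (\<sigma> \<otimes> \<tau>) = Suc (max (rank \<sigma>) (rank \<tau>))"

definition rank_bounded :: "nat \<Rightarrow> tm \<Rightarrow> bool" where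
  "rank_bounded n t \<longleftrightarrow> (\<forall>s\<in>subterms t. \<forall>\<sigma>. type_of s = Some \<sigma> \<longrightarrow> rank \<sigma> \<le> n)"


section \<open>Interpretation as functionals of finite type\<close>

text \<open>
  No single HOL type can be shown to contain the full set-theoretic functionals
  of all finite types (they have cardinality beth-omega). A term involves only
  finitely many types, though, so it is interpreted in a HOL type
  \<open>'v\<close> that hosts the full hierarchy up to a sufficiently large
  rank \<open>n\<close>: \<open>carr \<sigma>\<close> is, up to coding, the set of
  naturals, the set of all functions, or the cartesian product. Pairing is
  indexed by types only because codes of values may be shared between types.
  The lemmas
  \<open>full_hierarchy_0\<close> and \<open>full_hierarchy_Suc\<close> below
  show that such a type exists for every given \<open>n\<close>.
\<close>

record 'v hierarchy =
  carr :: "ty \<Rightarrow> 'v set"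
  num :: "nat \<Rightarrow> 'v"
  app :: "'v \<Rightarrow> 'v \<Rightarrow> 'v"
  pair :: "ty \<Rightarrow> ty \<Rightarrow> 'v \<Rightarrow> 'v \<Rightarrow> 'v"

definition full_hierarchy :: "nat \<Rightarrow> 'v hierarchy \<Rightarrow> bool" where
  "full_hierarchy n H \<longleftrightarrow>
     bij_betw (num H) UNIV (carr H NatT) \<and>
     (\<forall>\<sigma> \<tau>. rank (\<sigma> \<Rrightarrow> \<tau>) \<le> n \<longrightarrow>
        bij_betw (\<lambda>v. restrict (app H v) (carr H \<sigma>))
          (carr H (\<sigma> \<Rrightarrow> \<tau>)) (carr H \<sigma> \<rightarrow>\<^sub>E carr H \<tau>)) \<and>
     (\<forall>\<sigma> \<tau>. rank (\<sigma> \<otimes> \<tau>) \<le> n \<longrightarrow>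
        bij_betw (\<lambda>(a, b). pair H \<sigma> \<tau> a b)
          (carr H \<sigma> \<times> carr H \<tau>) (carr H (\<sigma> \<otimes> \<tau>)))"

definition unnum :: "'v hierarchy \<Rightarrow> 'v \<Rightarrow> nat" where
  "unnum H = inv (num H)"

definition abstr :: "'v hierarchy \<Rightarrow> ty \<Rightarrow> ty \<Rightarrow> ('v \<Rightarrow> 'v) \<Rightarrow> 'v" where
  "abstr H \<sigma> \<tau> F = (THE v. v \<in> carr H (\<sigma> \<Rrightarrow> \<tau>) \<and> (\<forall>a\<in>carr H \<sigma>. app H v a = F a))"

primrec eval :: "'v hierarchy \<Rightarrow> (string \<times> ty \<Rightarrow> 'v) \<Rightarrow> tm \<Rightarrow> 'v" where
  "eval H \<rho> (Var x \<sigma>) = \<rho> (x, \<sigma>)"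
| "eval H \<rho> (Lam x \<sigma> t) =
     abstr H \<sigma> (the (type_of t)) (\<lambda>a. eval H (\<rho>((x, \<sigma>) := a)) t)"
| "eval H \<rho> (t \<cdot> u) = app H (eval H \<rho> t) (eval H \<rho> u)"
| "eval H \<rho> Zero = num H 0"
| "eval H \<rho> Succ = abstr H NatT NatT (\<lambda>a. num H (Suc (unnum H a)))"
| "eval H \<rho> (Rec \<sigma>) =
     abstr H \<sigma> ((NatT \<Rrightarrow> \<sigma> \<Rrightarrow> \<sigma>) \<Rrightarrow> NatT \<Rrightarrow> \<sigma>) (\<lambda>a.
       abstr H (NatT \<Rrightarrow> \<sigma> \<Rrightarrow> \<sigma>) (NatT \<Rrightarrow> \<sigma>) (\<lambda>f.
         abstr H NatT \<sigma> (\<lambda>m.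
           rec_nat a (\<lambda>k r. app H (app H f (num H k)) r) (unnum H m))))"
| "eval H \<rho> (Mkpair \<sigma> \<tau>) =
     abstr H \<sigma> (\<tau> \<Rrightarrow> \<sigma> \<otimes> \<tau>) (\<lambda>a. abstr H \<tau> (\<sigma> \<otimes> \<tau>) (\<lambda>b. pair H \<sigma> \<tau> a b))"
| "eval H \<rho> (Pr1 \<sigma> \<tau>) =
     abstr H (\<sigma> \<otimes> \<tau>) \<sigma> (\<lambda>p. THE a. a \<in> carr H \<sigma> \<and> (\<exists>b\<in>carr H \<tau>. p = pair H \<sigma> \<tau> a b))"
| "eval H \<rho> (Pr2 \<sigma> \<tau>) =
     abstr H (\<sigma> \<otimes> \<tau>) \<tau> (\<lambda>p. THE b. b \<in> carr H \<tau> \<and> (\<exists>a\<in>carr H \<sigma>. p = pair H \<sigma> \<tau> a b))"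

text \<open>
  The functional on HOL functions denoted by a closed term of type
  \<open>(NatT \<Rrightarrow> NatT) \<Rrightarrow> NatT\<close>; the environment is
  irrelevant for closed terms.
\<close>

definition functional :: "'v hierarchy \<Rightarrow> tm \<Rightarrow> (nat \<Rightarrow> nat) \<Rightarrow> nat" where
  "functional H t \<alpha> =
     unnum H (app H (eval H (\<lambda>_. undefined) t)
                    (abstr H NatT NatT (\<lambda>a. num H (\<alpha> (unnum H a)))))"

lemma full_hierarchy_0: "\<exists>H :: nat hierarchy. full_hierarchy 0 H"
proof
  show "full_hierarchy 0
    (\<lparr>carr = \<lambda>_. UNIV, num = id, app = \<lambda>_. id, pair = \<lambda>_ _ _. id\<rparr> :: nat hierarchy)"
    by (simp add: full_hierarchy_def bij_betw_def)
qed

type_synonym 'v next_level = "'v + ('v \<Rightarrow> 'v) + 'v \<times> 'v"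

lemma full_hierarchy_Suc:
  fixes H :: "'v hierarchy"
  assumes H: "full_hierarchy n H"
  shows "\<exists>K :: 'v next_level hierarchy. full_hierarchy (Suc n) K"
proof -
  define D :: "ty \<Rightarrow> 'v next_level set" where
    "D = (\<lambda>\<sigma>. if rank \<sigma> \<le> n then Inl ` carr H \<sigma> else
       (case \<sigma> of NatT \<Rightarrow> {}
        | \<sigma>' \<Rrightarrow> \<tau>' \<Rightarrow> (Inr \<circ> Inl) ` (carr H \<sigma>' \<rightarrow>\<^sub>E carr H \<tau>')
        | \<sigma>' \<otimes> \<tau>' \<Rightarrow> (Inr \<circ> Inr) ` (carr H \<sigma>' \<times> carr H \<tau>')))"
  define A :: "'v next_level \<Rightarrow> 'v next_level \<Rightarrow> 'v next_level" where
    "A = (\<lambda>v u. case v of Inl v' \<Rightarrow> Inl (app H v' (projl u))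
       | Inr w \<Rightarrow> (case w of Inl g \<Rightarrow> Inl (g (projl u)) | Inr _ \<Rightarrow> undefined))"
  define P :: "ty \<Rightarrow> ty \<Rightarrow> 'v next_level \<Rightarrow> 'v next_level \<Rightarrow> 'v next_level" where
    "P = (\<lambda>\<sigma> \<tau> a b. if rank (\<sigma> \<otimes> \<tau>) \<le> n then Inl (pair H \<sigma> \<tau> (projl a) (projl b))
       else Inr (Inr (projl a, projl b)))"
  define K where "K = \<lparr>carr = D, num = Inl \<circ> num H, app = A, pair = P\<rparr>"
  have low: "D \<sigma> = Inl ` carr H \<sigma>" if "rank \<sigma> \<le> n" for \<sigma>
    using that by (simp add: D_def)
  have lift: "bij_betw (\<lambda>h. restrict (Inl \<circ> h \<circ> projl) (Inl ` X)) (X \<rightarrow>\<^sub>E Y)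
      ((Inl ` X :: 'v next_level set) \<rightarrow>\<^sub>E (Inl ` Y :: 'v next_level set))"
    for X Y :: "'v set"
  proof (rule bij_betw_byWitness[where f' = "\<lambda>k. restrict (projl \<circ> k \<circ> Inl) X"])
    show "\<forall>h\<in>X \<rightarrow>\<^sub>E Y. restrict (projl \<circ> (restrict (Inl \<circ> h \<circ> projl) (Inl ` X) :: 'v next_level \<Rightarrow> 'v next_level) \<circ> Inl) X = h"
      by (auto simp: fun_eq_iff restrict_def PiE_def extensional_def)
    show "\<forall>k\<in>((Inl ` X :: 'v next_level set) \<rightarrow>\<^sub>E (Inl ` Y :: 'v next_level set)).
        restrict (Inl \<circ> restrict (projl \<circ> k \<circ> Inl) X \<circ> projl) (Inl ` X) = k"
    proof
      fix k :: "'v next_level \<Rightarrow> 'v next_level"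
      assume k: "k \<in> (Inl ` X) \<rightarrow>\<^sub>E Inl ` Y"
      have "Inl (projl (k (Inl a))) = k (Inl a)" if "a \<in> X" for a
        using PiE_mem[OF k, of "Inl a"] that by auto
      moreover have "k u = undefined" if "u \<notin> Inl ` X" for u
        using PiE_arb[OF k] that by auto
      ultimately show "restrict (Inl \<circ> restrict (projl \<circ> k \<circ> Inl) X \<circ> projl) (Inl ` X) = k"
        by (auto simp: fun_eq_iff restrict_def)
    qed
  qed (force simp: PiE_iff)+
  have "full_hierarchy (Suc n) K"
    unfolding full_hierarchy_def
  proof (intro conjI allI impI)
    show "bij_betw (num K) UNIV (carr K NatT)"
      using H by (auto simp: full_hierarchy_def K_def low bij_betw_def inj_on_def)
  next
    fix \<sigma> \<tau> assume r: "rank (\<sigma> \<Rrightarrow> \<tau>) \<le> Suc n"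
    have D: "D \<sigma> = Inl ` carr H \<sigma>" "D \<tau> = Inl ` carr H \<tau>"
      using r by (simp_all add: low)
    define R where "R = (\<lambda>v. restrict (A v) (D \<sigma>))"
    have "bij_betw R (D (\<sigma> \<Rrightarrow> \<tau>)) (D \<sigma> \<rightarrow>\<^sub>E D \<tau>)"
    proof (cases "rank (\<sigma> \<Rrightarrow> \<tau>) \<le> n")
      case True
      have "bij_betw (\<lambda>v. restrict (app H v) (carr H \<sigma>)) (carr H (\<sigma> \<Rrightarrow> \<tau>)) (carr H \<sigma> \<rightarrow>\<^sub>E carr H \<tau>)"
        using H True by (simp add: full_hierarchy_def)
      from bij_betw_trans[OF this lift]
      have "bij_betw (R \<circ> Inl) (carr H (\<sigma> \<Rrightarrow> \<tau>)) (D \<sigma> \<rightarrow>\<^sub>E D \<tau>)"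
        unfolding D by (rule bij_betw_cong[THEN iffD1, rotated])
          (auto simp: R_def A_def D fun_eq_iff restrict_def)
      then show ?thesis
        unfolding low[OF True] by (simp add: bij_betw_def inj_on_def image_image)
    next
      case False
      have DA: "D (\<sigma> \<Rrightarrow> \<tau>) = (Inr \<circ> Inl) ` (carr H \<sigma> \<rightarrow>\<^sub>E carr H \<tau>)"
        using False by (simp add: D_def)
      have "bij_betw (R \<circ> (Inr \<circ> Inl)) (carr H \<sigma> \<rightarrow>\<^sub>E carr H \<tau>) (D \<sigma> \<rightarrow>\<^sub>E D \<tau>)"
        unfolding D by (rule bij_betw_cong[THEN iffD1, OF _ lift])
          (auto simp: R_def A_def D fun_eq_iff restrict_def)
      then show ?thesis
        unfolding DA by (simp add: bij_betw_def inj_on_def image_image)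
    qed
    then show "bij_betw (\<lambda>v. restrict (app K v) (carr K \<sigma>)) (carr K (\<sigma> \<Rrightarrow> \<tau>)) (carr K \<sigma> \<rightarrow>\<^sub>E carr K \<tau>)"
      by (simp add: K_def R_def)
  next
    fix \<sigma> \<tau> assume r: "rank (\<sigma> \<otimes> \<tau>) \<le> Suc n"
    have D: "D \<sigma> = Inl ` carr H \<sigma>" "D \<tau> = Inl ` carr H \<tau>"
      using r by (simp_all add: low)
    have "bij_betw (\<lambda>(a, b). P \<sigma> \<tau> a b) (D \<sigma> \<times> D \<tau>) (D (\<sigma> \<otimes> \<tau>))"
    proof (cases "rank (\<sigma> \<otimes> \<tau>) \<le> n")
      case True
      have b: "bij_betw (\<lambda>(a, b). pair H \<sigma> \<tau> a b) (carr H \<sigma> \<times> carr H \<tau>) (carr H (\<sigma> \<otimes> \<tau>))"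
        using H True by (simp add: full_hierarchy_def)
      have "inj_on (\<lambda>(a, b). P \<sigma> \<tau> a b) (D \<sigma> \<times> D \<tau>)"
        using b True by (auto simp: P_def D bij_betw_def inj_on_def)
      moreover have "(\<lambda>(a, b). P \<sigma> \<tau> a b) ` (D \<sigma> \<times> D \<tau>)
          = Inl ` (\<lambda>(a, b). pair H \<sigma> \<tau> a b) ` (carr H \<sigma> \<times> carr H \<tau>)"
        using True unfolding D map_prod_surj_on[OF refl refl, symmetric] image_image
        by (intro image_cong) (auto simp: P_def)
      then have "(\<lambda>(a, b). P \<sigma> \<tau> a b) ` (D \<sigma> \<times> D \<tau>) = D (\<sigma> \<otimes> \<tau>)"
        by (simp add: bij_betw_imp_surj_on[OF b] low[OF True])
      ultimately show ?thesis by (simp add: bij_betw_def)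
    next
      case False
      have "inj_on (\<lambda>(a, b). P \<sigma> \<tau> a b) (D \<sigma> \<times> D \<tau>)"
        using False by (auto simp: P_def D inj_on_def)
      moreover have "(\<lambda>(a, b). P \<sigma> \<tau> a b) ` (D \<sigma> \<times> D \<tau>)
          = (Inr \<circ> Inr) ` (carr H \<sigma> \<times> carr H \<tau>)"
        using False unfolding D map_prod_surj_on[OF refl refl, symmetric] image_image
        by (intro image_cong) (auto simp: P_def)
      moreover have "D (\<sigma> \<otimes> \<tau>) = (Inr \<circ> Inr) ` (carr H \<sigma> \<times> carr H \<tau>)"
        using False by (simp add: D_def)
      ultimately show ?thesis by (simp add: bij_betw_def)
    qed
    then show "bij_betw (\<lambda>(a, b). pair K \<sigma> \<tau> a b) (carr K \<sigma> \<times> carr K \<tau>) (carr K (\<sigma> \<otimes> \<tau>))"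
      by (simp add: K_def)
  qed
  then show ?thesis by blast
qed


section \<open>The translation induced by a nucleus\<close>

record nucleus =
  base :: ty
  eta :: tm
  kappa :: tm

primrec J_ty :: "nucleus \<Rightarrow> ty \<Rightarrow> ty" where
  "J_ty \<N> NatT = base \<N>"
| "J_ty \<N> (\<sigma> \<Rrightarrow> \<tau>) = J_ty \<N> \<sigma> \<Rrightarrow> J_ty \<N> \<tau>"
| "J_ty \<N> (\<sigma> \<otimes> \<tau>) = J_ty \<N> \<sigma> \<otimes> J_ty \<N> \<tau>"

primrec ke :: "nucleus \<Rightarrow> ty \<Rightarrow> tm" where
  "ke \<N> NatT = kappa \<N>"
| "ke \<N> (\<sigma> \<Rrightarrow> \<tau>) =
    (let G = NatT \<Rrightarrow> J_ty \<N> (\<sigma> \<Rrightarrow> \<tau>); S = J_ty \<N> \<sigma>;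
         g = Var ''g'' G; a = Var ''a'' (base \<N>); x = Var ''x'' S; n = Var ''n'' NatT
     in Lam ''g'' G (Lam ''a'' (base \<N>) (Lam ''x'' S
          (ke \<N> \<tau> \<cdot> Lam ''n'' NatT (g \<cdot> n \<cdot> x) \<cdot> a))))"
| "ke \<N> (\<sigma> \<otimes> \<tau>) =
    (let G = NatT \<Rrightarrow> J_ty \<N> (\<sigma> \<otimes> \<tau>); S = J_ty \<N> \<sigma>; T = J_ty \<N> \<tau>;
         g = Var ''g'' G; a = Var ''a'' (base \<N>); n = Var ''n'' NatT
     in Lam ''g'' G (Lam ''a'' (base \<N>)
          (Mkpair S T \<cdot> (ke \<N> \<sigma> \<cdot> Lam ''n'' NatT (Pr1 S T \<cdot> (g \<cdot> n)) \<cdot> a)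
                      \<cdot> (ke \<N> \<tau> \<cdot> Lam ''n'' NatT (Pr2 S T \<cdot> (g \<cdot> n)) \<cdot> a))))"

text \<open>
  A variable keeps its name and changes its type; since \<open>J_ty \<N>\<close> is
  injective, distinct variables are sent to distinct variables. The terms
  \<open>eta \<N>\<close> and \<open>kappa \<N>\<close> are meant to be closed, so
  nothing is captured.
\<close>

primrec J_tm :: "nucleus \<Rightarrow> tm \<Rightarrow> tm" where
  "J_tm \<N> (Var x \<sigma>) = Var x (J_ty \<N> \<sigma>)"
| "J_tm \<N> (Lam x \<sigma> t) = Lam x (J_ty \<N> \<sigma>) (J_tm \<N> t)"
| "J_tm \<N> (t \<cdot> u) = J_tm \<N> t \<cdot> J_tm \<N> u"
| "J_tm \<N> Zero = eta \<N> \<cdot> Zero"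
| "J_tm \<N> Succ = kappa \<N> \<cdot> Lam ''n'' NatT (eta \<N> \<cdot> (Succ \<cdot> Var ''n'' NatT))"
| "J_tm \<N> (Rec \<sigma>) =
    (let S = J_ty \<N> \<sigma>; F = base \<N> \<Rrightarrow> S \<Rrightarrow> S;
         x = Var ''x'' S; f = Var ''f'' F; n = Var ''n'' NatT
     in Lam ''x'' S (Lam ''f'' F
          (ke \<N> \<sigma> \<cdot> (Rec S \<cdot> x \<cdot> Lam ''n'' NatT (f \<cdot> (eta \<N> \<cdot> n))))))"
| "J_tm \<N> (Mkpair \<sigma> \<tau>) = Mkpair (J_ty \<N> \<sigma>) (J_ty \<N> \<tau>)"
| "J_tm \<N> (Pr1 \<sigma> \<tau>) = Pr1 (J_ty \<N> \<sigma>) (J_ty \<N> \<tau>)"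
| "J_tm \<N> (Pr2 \<sigma> \<tau>) = Pr2 (J_ty \<N> \<sigma>) (J_ty \<N> \<tau>)"


section \<open>The nucleus for moduli of continuity\<close>

abbreviation Baire :: ty where
  "Baire \<equiv> NatT \<Rrightarrow> NatT"

abbreviation JN :: ty where
  "JN \<equiv> (Baire \<Rrightarrow> NatT) \<otimes> (Baire \<Rrightarrow> NatT)"

abbreviation Vcomp :: "tm \<Rightarrow> tm" where
  "Vcomp w \<equiv> Pr1 (Baire \<Rrightarrow> NatT) (Baire \<Rrightarrow> NatT) \<cdot> w"

abbreviation Mcomp :: "tm \<Rightarrow> tm" where
  "Mcomp w \<equiv> Pr2 (Baire \<Rrightarrow> NatT) (Baire \<Rrightarrow> NatT) \<cdot> w"

abbreviation mkJ :: "tm \<Rightarrow> tm \<Rightarrow> tm" where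
  "mkJ v m \<equiv> Mkpair (Baire \<Rrightarrow> NatT) (Baire \<Rrightarrow> NatT) \<cdot> v \<cdot> m"

text \<open>
  The maximum by double recursion: \<open>max 0 n = n\<close>,
  \<open>max (m+1) 0 = m+1\<close>, \<open>max (m+1) (n+1) = max m n + 1\<close>.
\<close>

definition max_tm :: tm where
  "max_tm =
    (let m = Var ''m'' NatT; n = Var ''n'' NatT; h = Var ''h'' Baire
     in Rec Baire \<cdot> Lam ''n'' NatT n
          \<cdot> Lam ''m'' NatT (Lam ''h'' Baire
               (Rec NatT \<cdot> (Succ \<cdot> m) \<cdot> Lam ''n'' NatT (Lam ''r'' NatT (Succ \<cdot> (h \<cdot> n))))))"

definition eta_c :: tm where
  "eta_c = Lam ''n'' NatT
     (mkJ (Lam ''alpha'' Baire (Var ''n'' NatT)) (Lam ''alpha'' Baire Zero))"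

definition kappa_c :: tm where
  "kappa_c =
    (let g = Var ''g'' (NatT \<Rrightarrow> JN); w = Var ''w'' JN; \<alpha> = Var ''alpha'' Baire
     in Lam ''g'' (NatT \<Rrightarrow> JN) (Lam ''w'' JN
          (mkJ (Lam ''alpha'' Baire (Vcomp (g \<cdot> (Vcomp w \<cdot> \<alpha>)) \<cdot> \<alpha>))
               (Lam ''alpha'' Baire (max_tm \<cdot> (Mcomp (g \<cdot> (Vcomp w \<cdot> \<alpha>)) \<cdot> \<alpha>) \<cdot> (Mcomp w \<cdot> \<alpha>))))))"

definition continuity_nucleus :: nucleus where
  "continuity_nucleus = \<lparr>base = JN, eta = eta_c, kappa = kappa_c\<rparr>"

definition Omega :: tm where
  "Omega =
    (let n = Var ''n'' NatT; \<alpha> = Var ''alpha'' Baire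
     in kappa_c \<cdot> Lam ''n'' NatT
          (mkJ (Lam ''alpha'' Baire (\<alpha> \<cdot> n)) (Lam ''alpha'' Baire (Succ \<cdot> n))))"

definition modulus_tm :: "tm \<Rightarrow> tm" where
  "modulus_tm f = Mcomp (J_tm continuity_nucleus f \<cdot> Omega)"

definition modulus_of_continuity :: "((nat \<Rightarrow> nat) \<Rightarrow> nat) \<Rightarrow> ((nat \<Rightarrow> nat) \<Rightarrow> nat) \<Rightarrow> bool" where
  "modulus_of_continuity \<mu> F \<longleftrightarrow>
     (\<forall>\<alpha> \<beta>. (\<forall>i<\<mu> \<alpha>. \<alpha> i = \<beta> i) \<longrightarrow> F \<alpha> = F \<beta>)"

end

theory Submission
  imports Defs
begin

text \<open>
  Fix \<open>\<alpha>\<close> and relate the values of type \<open>\<sigma>\<^sup>J\<close> to those of type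
  \<open>\<sigma>\<close> by the logical relation that at base type relates \<open>w\<close> to
  \<open>m\<close> if \<open>V\<^sub>w \<alpha> = m\<close> and \<open>M\<^sub>w\<close> is a modulus of
  continuity of \<open>V\<^sub>w\<close>. The operation \<open>\<kappa>\<close> preserves it: if two sequences
  agree below the maximum in the second component of \<open>\<kappa>(g, w)\<close>, then \<open>V\<^sub>w\<close> takes the
  same value \<open>k\<close> on both, and hence so does \<open>V\<close> of \<open>g k\<close>. So every
  term is related to its translation. Since \<open>\<Omega>\<close> is related to
  \<open>\<alpha>\<close>, \<open>w = f\<^sup>J \<Omega>\<close> is related to \<open>f \<alpha>\<close>, for
  every \<open>\<alpha>\<close>; thus \<open>V\<^sub>w = f\<close>, with modulus \<open>M\<^sub>w\<close>.
\<close>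

section \<open>Rank bounds, projections and environments\<close>

declare rank.simps [simp del]

lemma rank_NatT [simp]: "rank NatT = 0"
  by (simp add: rank.simps)

text \<open>Ranks stay folded from here on, so that a bound keeps the form
  \<open>rank (\<sigma> \<Rrightarrow> \<tau>) \<le> n\<close> in which the fullness conditions ask
  for it. This is the way down from an arrow to its components.\<close>

lemma rank_ArrowD:
  assumes "rank (\<sigma> \<Rrightarrow> \<tau>) \<le> n"
  shows "rank \<sigma> \<le> n" "rank \<tau> \<le> n"
  using assms by (simp_all add: rank.simps)

text \<open>Beyond the subterms of its parts a term contributes only itself, so the quantifier over
  all subterms reduces to one local condition per constructor.\<close>

lemma rank_bounded_simps [simp]:
  "rank_bounded n (Var x \<sigma>) \<longleftrightarrow> rank \<sigma> \<le> n"
  "rank_bounded n (Lam x \<sigma> t) \<longleftrightarrow>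
     rank_bounded n t \<and> (\<forall>\<tau>. type_of t = Some \<tau> \<longrightarrow> rank (\<sigma> \<Rrightarrow> \<tau>) \<le> n)"
  "rank_bounded n (t \<cdot> u) \<longleftrightarrow>
     rank_bounded n t \<and> rank_bounded n u \<and> (\<forall>\<tau>. type_of (t \<cdot> u) = Some \<tau> \<longrightarrow> rank \<tau> \<le> n)"
  "rank_bounded n Zero"
  "rank_bounded n Succ \<longleftrightarrow> rank (NatT \<Rrightarrow> NatT) \<le> n"
  "rank_bounded n (Rec \<sigma>) \<longleftrightarrow> rank (\<sigma> \<Rrightarrow> (NatT \<Rrightarrow> \<sigma> \<Rrightarrow> \<sigma>) \<Rrightarrow> NatT \<Rrightarrow> \<sigma>) \<le> n"
  "rank_bounded n (Mkpair \<sigma> \<tau>) \<longleftrightarrow> rank (\<sigma> \<Rrightarrow> \<tau> \<Rrightarrow> \<sigma> \<otimes> \<tau>) \<le> n"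
  "rank_bounded n (Pr1 \<sigma> \<tau>) \<longleftrightarrow> rank (\<sigma> \<otimes> \<tau> \<Rrightarrow> \<sigma>) \<le> n"
  "rank_bounded n (Pr2 \<sigma> \<tau>) \<longleftrightarrow> rank (\<sigma> \<otimes> \<tau> \<Rrightarrow> \<tau>) \<le> n"
  by (auto simp: rank_bounded_def)

lemma type_of_App_Some:
  "type_of (t \<cdot> u) = Some \<tau> \<longleftrightarrow> (\<exists>\<sigma>. type_of t = Some (\<sigma> \<Rrightarrow> \<tau>) \<and> type_of u = Some \<sigma>)"
  by (auto split: option.splits ty.splits)

lemma rank_bounded_type:
  assumes "type_of t = Some \<tau>" "rank_bounded n t"
  shows "rank \<tau> \<le> n"
proof -
  have "t \<in> subterms t" by (cases t) auto
  with assms show ?thesis by (auto simp: rank_bounded_def)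
qed

lemma type_of_max_tm [simp]: "type_of max_tm = Some (NatT \<Rrightarrow> Baire)"
  by (simp add: max_tm_def Let_def)

lemma free_vars_max_tm [simp]: "free_vars max_tm = {}"
  by (auto simp: max_tm_def Let_def)

text \<open>The bodies of \<open>proj1\<close> and \<open>proj2\<close> are the descriptions inside
  \<open>eval\<close> of \<open>Pr1\<close> and \<open>Pr2\<close>. Naming them allows these
  descriptions to be folded as soon as they appear.\<close>

definition proj1 :: "'v hierarchy \<Rightarrow> ty \<Rightarrow> ty \<Rightarrow> 'v \<Rightarrow> 'v" where
  "proj1 H \<sigma> \<tau> p = (THE a. a \<in> carr H \<sigma> \<and> (\<exists>b\<in>carr H \<tau>. p = pair H \<sigma> \<tau> a b))"

definition proj2 :: "'v hierarchy \<Rightarrow> ty \<Rightarrow> ty \<Rightarrow> 'v \<Rightarrow> 'v" where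
  "proj2 H \<sigma> \<tau> p = (THE b. b \<in> carr H \<tau> \<and> (\<exists>a\<in>carr H \<sigma>. p = pair H \<sigma> \<tau> a b))"

text \<open>Restricting the condition to free variables makes every environment admissible for a
  closed term, in particular the constant \<open>undefined\<close> one inside
  \<open>functional\<close>.\<close>

definition env_ok :: "'v hierarchy \<Rightarrow> (string \<times> ty \<Rightarrow> 'v) \<Rightarrow> tm \<Rightarrow> bool" where
  "env_ok H \<rho> t \<longleftrightarrow> (\<forall>(x, \<sigma>)\<in>free_vars t. \<rho> (x, \<sigma>) \<in> carr H \<sigma>)"

lemma env_ok_simps [simp]:
  "env_ok H \<rho> (Var x \<sigma>) \<longleftrightarrow> \<rho> (x, \<sigma>) \<in> carr H \<sigma>"
  "env_ok H \<rho> (t \<cdot> u) \<longleftrightarrow> env_ok H \<rho> t \<and> env_ok H \<rho> u"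
  "env_ok H \<rho> Zero" "env_ok H \<rho> Succ" "env_ok H \<rho> (Rec \<sigma>)"
  "env_ok H \<rho> (Mkpair \<sigma> \<tau>)" "env_ok H \<rho> (Pr1 \<sigma> \<tau>)" "env_ok H \<rho> (Pr2 \<sigma> \<tau>)"
  by (auto simp: env_ok_def)

lemma env_ok_upd: "env_ok H \<rho> (Lam x \<sigma> t) \<Longrightarrow> a \<in> carr H \<sigma> \<Longrightarrow> env_ok H (\<rho>((x, \<sigma>) := a)) t"
  by (auto simp: env_ok_def)

lemma env_ok_closed: "free_vars t = {} \<Longrightarrow> env_ok H \<rho> t"
  by (simp add: env_ok_def)

section \<open>Well-definedness of evaluation in a full hierarchy\<close>

locale finite_types =
  fixes n :: nat and H :: "'v hierarchy"
  assumes full: "full_hierarchy n H"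
begin

lemma num_carr [simp]: "num H k \<in> carr H NatT"
  using full by (auto simp: full_hierarchy_def bij_betw_def)

lemma unnum_num [simp]: "unnum H (num H k) = k"
  using full by (auto simp: full_hierarchy_def bij_betw_def unnum_def)

lemma num_unnum: "a \<in> carr H NatT \<Longrightarrow> num H (unnum H a) = a"
  using full by (metis UNIV_I bij_betw_imp_surj_on f_inv_into_f full_hierarchy_def unnum_def)

lemma app_carr:
  assumes "v \<in> carr H (\<sigma> \<Rrightarrow> \<tau>)" "a \<in> carr H \<sigma>" "rank (\<sigma> \<Rrightarrow> \<tau>) \<le> n"
  shows "app H v a \<in> carr H \<tau>"
proof -
  have "bij_betw (\<lambda>v. restrict (app H v) (carr H \<sigma>))
          (carr H (\<sigma> \<Rrightarrow> \<tau>)) (carr H \<sigma> \<rightarrow>\<^sub>E carr H \<tau>)"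
    using full assms(3) by (auto simp: full_hierarchy_def)
  from bij_betwE[OF this] assms(1)
  have "restrict (app H v) (carr H \<sigma>) \<in> carr H \<sigma> \<rightarrow>\<^sub>E carr H \<tau>" by blast
  with assms(2) show ?thesis by (auto simp: PiE_iff)
qed

text \<open>Application is a bijection from the codes onto the extensional functions: surjectivity
  gives a code for \<open>F\<close>, injectivity its uniqueness, so the description in
  \<open>abstr\<close> denotes.\<close>

lemma abstr_correct:
  assumes r: "rank (\<sigma> \<Rrightarrow> \<tau>) \<le> n" and F: "\<And>a. a \<in> carr H \<sigma> \<Longrightarrow> F a \<in> carr H \<tau>"
  shows "abstr H \<sigma> \<tau> F \<in> carr H (\<sigma> \<Rrightarrow> \<tau>) \<and> (\<forall>a\<in>carr H \<sigma>. app H (abstr H \<sigma> \<tau> F) a = F a)"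
proof -
  have b: "bij_betw (\<lambda>v. restrict (app H v) (carr H \<sigma>))
          (carr H (\<sigma> \<Rrightarrow> \<tau>)) (carr H \<sigma> \<rightarrow>\<^sub>E carr H \<tau>)"
    using full r by (auto simp: full_hierarchy_def)
  have "restrict F (carr H \<sigma>) \<in> carr H \<sigma> \<rightarrow>\<^sub>E carr H \<tau>" using F by auto
  then obtain v where v: "v \<in> carr H (\<sigma> \<Rrightarrow> \<tau>)"
    "restrict (app H v) (carr H \<sigma>) = restrict F (carr H \<sigma>)"
    using b by (metis (no_types, lifting) bij_betw_imp_surj_on imageE)
  have "\<exists>!v. v \<in> carr H (\<sigma> \<Rrightarrow> \<tau>) \<and> (\<forall>a\<in>carr H \<sigma>. app H v a = F a)"
  proof (rule ex1I)
    show "v \<in> carr H (\<sigma> \<Rrightarrow> \<tau>) \<and> (\<forall>a\<in>carr H \<sigma>. app H v a = F a)"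
      using v by (metis restrict_apply')
    fix w assume w: "w \<in> carr H (\<sigma> \<Rrightarrow> \<tau>) \<and> (\<forall>a\<in>carr H \<sigma>. app H w a = F a)"
    then have "restrict (app H w) (carr H \<sigma>) = restrict (app H v) (carr H \<sigma>)"
      unfolding v(2) by (auto simp: restrict_def)
    with b v(1) w show "w = v" by (auto simp: bij_betw_def inj_on_def)
  qed
  from theI'[OF this] show ?thesis by (simp add: abstr_def)
qed

lemmas abstr_carr = abstr_correct[THEN conjunct1]
lemmas app_abstr = abstr_correct[THEN conjunct2, THEN bspec]

lemma pair_bij:
  "rank (\<sigma> \<otimes> \<tau>) \<le> n \<Longrightarrow>
    bij_betw (\<lambda>(a, b). pair H \<sigma> \<tau> a b) (carr H \<sigma> \<times> carr H \<tau>) (carr H (\<sigma> \<otimes> \<tau>))"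
  using full by (auto simp: full_hierarchy_def)

lemma pair_carr:
  "rank (\<sigma> \<otimes> \<tau>) \<le> n \<Longrightarrow> a \<in> carr H \<sigma> \<Longrightarrow> b \<in> carr H \<tau> \<Longrightarrow> pair H \<sigma> \<tau> a b \<in> carr H (\<sigma> \<otimes> \<tau>)"
  using pair_bij[of \<sigma> \<tau>] by (auto dest!: bij_betwE)

lemma pair_inject:
  assumes "rank (\<sigma> \<otimes> \<tau>) \<le> n" "a \<in> carr H \<sigma>" "b \<in> carr H \<tau>" "a' \<in> carr H \<sigma>" "b' \<in> carr H \<tau>"
  shows "pair H \<sigma> \<tau> a b = pair H \<sigma> \<tau> a' b' \<longleftrightarrow> a = a' \<and> b = b'"
  using pair_bij[OF assms(1)] assms(2-) by (auto simp: bij_betw_def inj_on_def)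

lemma Times_cases:
  assumes "rank (\<sigma> \<otimes> \<tau>) \<le> n" "p \<in> carr H (\<sigma> \<otimes> \<tau>)"
  obtains a b where "a \<in> carr H \<sigma>" "b \<in> carr H \<tau>" "p = pair H \<sigma> \<tau> a b"
proof -
  from assms(2) have "p \<in> (\<lambda>(a, b). pair H \<sigma> \<tau> a b) ` (carr H \<sigma> \<times> carr H \<tau>)"
    unfolding bij_betw_imp_surj_on[OF pair_bij[OF assms(1)]] .
  with that show ?thesis by auto
qed

lemma proj_pair:
  assumes "rank (\<sigma> \<otimes> \<tau>) \<le> n" "a \<in> carr H \<sigma>" "b \<in> carr H \<tau>"
  shows "proj1 H \<sigma> \<tau> (pair H \<sigma> \<tau> a b) = a" "proj2 H \<sigma> \<tau> (pair H \<sigma> \<tau> a b) = b"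
  unfolding proj1_def proj2_def using assms by (auto intro!: the_equality simp: pair_inject)

lemma proj_carr:
  assumes "rank (\<sigma> \<otimes> \<tau>) \<le> n" "p \<in> carr H (\<sigma> \<otimes> \<tau>)"
  shows "proj1 H \<sigma> \<tau> p \<in> carr H \<sigma>" "proj2 H \<sigma> \<tau> p \<in> carr H \<tau>"
  using Times_cases[OF assms] proj_pair[OF assms(1)] by metis+

lemma rec_carr:
  assumes "rank (NatT \<Rrightarrow> \<sigma> \<Rrightarrow> \<sigma>) \<le> n" "a \<in> carr H \<sigma>" "f \<in> carr H (NatT \<Rrightarrow> \<sigma> \<Rrightarrow> \<sigma>)"
  shows "rec_nat a (\<lambda>k r. app H (app H f (num H k)) r) m \<in> carr H \<sigma>"
proof (induction m)
  case (Suc m)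
  have "app H f (num H m) \<in> carr H (\<sigma> \<Rrightarrow> \<sigma>)"
    using assms by (auto intro: app_carr)
  with Suc show ?case using assms(1) by (auto intro: app_carr rank_ArrowD)
qed (use assms in simp)

text \<open>The rank bound guarantees that each \<open>abstr\<close> met during evaluation is taken
  at a type where the hierarchy is full, so that \<open>abstr_carr\<close> applies.\<close>

lemma eval_carr:
  "type_of t = Some \<tau> \<Longrightarrow> rank_bounded n t \<Longrightarrow> env_ok H \<rho> t \<Longrightarrow> eval H \<rho> t \<in> carr H \<tau>"
proof (induction t arbitrary: \<tau> \<rho>)
  case (Lam x \<sigma> t)
  then obtain \<tau>' where "type_of t = Some \<tau>'" "\<tau> = \<sigma> \<Rrightarrow> \<tau>'" by auto
  with Lam show ?case by (auto intro!: abstr_carr Lam.IH env_ok_upd)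
next
  case (App t u)
  from App.prems obtain \<sigma> where "type_of t = Some (\<sigma> \<Rrightarrow> \<tau>)" "type_of u = Some \<sigma>"
    by (auto simp: type_of_App_Some simp del: type_of.simps)
  with App show ?case by (auto intro!: app_carr[of _ \<sigma>] intro: rank_bounded_type)
next
  case (Rec \<sigma>)
  then show ?case by (auto intro!: abstr_carr rec_carr dest: rank_ArrowD)
next
  case (Mkpair \<sigma> \<tau>)
  then show ?case by (auto intro!: abstr_carr pair_carr dest: rank_ArrowD)
next
  case (Pr1 \<sigma> \<tau>)
  then show ?case
    by (auto intro!: abstr_carr proj_carr dest: rank_ArrowD simp flip: proj1_def)
next
  case (Pr2 \<sigma> \<tau>)
  then show ?case
    by (auto intro!: abstr_carr proj_carr dest: rank_ArrowD simp flip: proj2_def)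
qed (auto intro!: abstr_carr)

section \<open>Computation rules for evaluated terms\<close>

lemma app_eval_Lam:
  assumes "type_of t = Some \<tau>" "rank_bounded n (Lam x \<sigma> t)" "env_ok H \<rho> (Lam x \<sigma> t)" "a \<in> carr H \<sigma>"
  shows "app H (eval H \<rho> (Lam x \<sigma> t)) a = eval H (\<rho>((x, \<sigma>) := a)) t"
  \<comment> \<open>\<open>eval_carr\<close> for the body provides the membership under which
    \<open>abstr\<close> computes.\<close>
  using assms by (auto intro!: app_abstr eval_carr intro: env_ok_upd)

text \<open>\<open>kappa_c\<close> and the composite cases of \<open>ke\<close> begin with two
  binders; this consumes both at once.\<close>

lemma app_eval_Lam2:
  assumes "type_of t = Some \<tau>" "rank_bounded n (Lam x \<sigma> (Lam y \<sigma>' t))"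
    "env_ok H \<rho> (Lam x \<sigma> (Lam y \<sigma>' t))" "a \<in> carr H \<sigma>" "b \<in> carr H \<sigma>'"
  shows "app H (app H (eval H \<rho> (Lam x \<sigma> (Lam y \<sigma>' t))) a) b =
    eval H (\<rho>((x, \<sigma>) := a, (y, \<sigma>') := b)) t"
proof -
  have "app H (eval H \<rho> (Lam x \<sigma> (Lam y \<sigma>' t))) a = eval H (\<rho>((x, \<sigma>) := a)) (Lam y \<sigma>' t)"
    using assms(1) by (intro app_eval_Lam[OF _ assms(2-4)]) simp
  then show ?thesis
    using app_eval_Lam[OF assms(1) _ env_ok_upd[OF assms(3,4)] assms(5)] assms(2) by simp
qed

lemma app_eval_Succ:
  assumes "rank (NatT \<Rrightarrow> NatT) \<le> n"
  shows "app H (eval H \<rho> Succ) (num H k) = num H (Suc k)"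
  using assms by (simp add: app_abstr)

lemma app_eval_Rec:
  assumes "rank (\<sigma> \<Rrightarrow> (NatT \<Rrightarrow> \<sigma> \<Rrightarrow> \<sigma>) \<Rrightarrow> NatT \<Rrightarrow> \<sigma>) \<le> n"
    "a \<in> carr H \<sigma>" "f \<in> carr H (NatT \<Rrightarrow> \<sigma> \<Rrightarrow> \<sigma>)"
  shows "app H (app H (app H (eval H \<rho> (Rec \<sigma>)) a) f) (num H k) =
    rec_nat a (\<lambda>k r. app H (app H f (num H k)) r) k"
proof -
  note r = assms(1) assms(1)[THEN rank_ArrowD(2)] assms(1)[THEN rank_ArrowD(2), THEN rank_ArrowD(2)]
    assms(1)[THEN rank_ArrowD(2), THEN rank_ArrowD(1)]
  show ?thesis using assms r by (simp add: app_abstr abstr_carr rec_carr)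
qed

lemma app_eval_Mkpair:
  assumes "rank (\<sigma> \<Rrightarrow> \<tau> \<Rrightarrow> \<sigma> \<otimes> \<tau>) \<le> n" "a \<in> carr H \<sigma>" "b \<in> carr H \<tau>"
  shows "app H (app H (eval H \<rho> (Mkpair \<sigma> \<tau>)) a) b = pair H \<sigma> \<tau> a b"
  using assms assms(1)[THEN rank_ArrowD(2)] assms(1)[THEN rank_ArrowD(2), THEN rank_ArrowD(2)]
  by (simp add: app_abstr abstr_carr pair_carr)

lemma app_eval_Pr:
  assumes "rank (\<sigma> \<otimes> \<tau>) \<le> n" "p \<in> carr H (\<sigma> \<otimes> \<tau>)"
  shows "rank (\<sigma> \<otimes> \<tau> \<Rrightarrow> \<sigma>) \<le> n \<Longrightarrow> app H (eval H \<rho> (Pr1 \<sigma> \<tau>)) p = proj1 H \<sigma> \<tau> p"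
    and "rank (\<sigma> \<otimes> \<tau> \<Rrightarrow> \<tau>) \<le> n \<Longrightarrow> app H (eval H \<rho> (Pr2 \<sigma> \<tau>)) p = proj2 H \<sigma> \<tau> p"
  using assms by (simp_all add: app_abstr proj_carr flip: proj1_def proj2_def)

text \<open>From here on abstractions and functional constants compute only through the
  \<open>app_eval\<close> rules, which keeps \<open>abstr\<close> out of the goals.\<close>

declare eval.simps(2) [simp del] eval.simps(5-9) [simp del]

section \<open>The nucleus evaluated in the hierarchy\<close>

abbreviation enc :: "(nat \<Rightarrow> nat) \<Rightarrow> 'v" where
  "enc \<alpha> \<equiv> abstr H NatT NatT (\<lambda>a. num H (\<alpha> (unnum H a)))"

text \<open>\<open>val w\<close> and \<open>modl w\<close> are the components V and M of
  \<open>w\<close>, decoded to functions on genuine sequences. The argument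
  \<open>enc \<alpha>\<close> is the one that \<open>functional\<close> supplies.\<close>

definition val :: "'v \<Rightarrow> (nat \<Rightarrow> nat) \<Rightarrow> nat" where
  "val w \<alpha> = unnum H (app H (proj1 H (Baire \<Rrightarrow> NatT) (Baire \<Rrightarrow> NatT) w) (enc \<alpha>))"

definition modl :: "'v \<Rightarrow> (nat \<Rightarrow> nat) \<Rightarrow> nat" where
  "modl w \<alpha> = unnum H (app H (proj2 H (Baire \<Rrightarrow> NatT) (Baire \<Rrightarrow> NatT) w) (enc \<alpha>))"

lemma enc_carr: "rank Baire \<le> n \<Longrightarrow> enc \<alpha> \<in> carr H Baire"
  by (rule abstr_carr) auto

lemma app_enc: "rank Baire \<le> n \<Longrightarrow> app H (enc \<alpha>) (num H k) = num H (\<alpha> k)"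
  by (simp add: app_abstr)

lemma eval_max:
  assumes "rank_bounded n max_tm"
  shows "app H (app H (eval H \<rho> max_tm) (num H i)) (num H j) = num H (max i j)"
proof -
  define F where "F = Lam ''m'' NatT (Lam ''h'' Baire (Rec NatT \<cdot> (Succ \<cdot> Var ''m'' NatT) \<cdot>
    Lam ''n'' NatT (Lam ''r'' NatT (Succ \<cdot> (Var ''h'' Baire \<cdot> Var ''n'' NatT)))))"
  define I where "I = Lam ''n'' NatT (Var ''n'' NatT)"
  \<comment> \<open>\<open>s i\<close> codes the function sending \<open>j\<close> to
    \<open>max i j\<close>; the outer recursor, at type \<open>Baire\<close>, produces these
    codes.\<close>
  define s where "s = rec_nat (eval H \<rho> I) (\<lambda>k r. app H (app H (eval H \<rho> F) (num H k)) r)"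
  have max_eq: "max_tm = Rec Baire \<cdot> I \<cdot> F"
    by (simp add: max_tm_def F_def I_def Let_def)
  have bI: "rank_bounded n I" and bF: "rank_bounded n F" and bR: "rank_bounded n (Rec Baire)"
    using assms by (auto simp: max_eq)
  have I: "eval H \<rho> I \<in> carr H Baire"
    using bI by (intro eval_carr) (auto simp: I_def env_ok_def)
  have F: "eval H \<rho> F \<in> carr H (NatT \<Rrightarrow> Baire \<Rrightarrow> Baire)"
    using bF by (intro eval_carr) (auto simp: F_def env_ok_def)
  have "app H (eval H \<rho> max_tm) (num H i) = s i"
    using bR I F by (simp add: max_eq app_eval_Rec s_def)
  moreover have s: "s i \<in> carr H Baire" for i
    unfolding s_def using bR I F by (intro rec_carr) (auto dest: rank_ArrowD)
  have "app H (s i) (num H j) = num H (max i j)"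
  \<comment> \<open>At a successor, \<open>s (Suc i)\<close> calls \<open>s i\<close> at the
    predecessor, so \<open>j\<close> has to stay general.\<close>
  proof (induction i arbitrary: j)
    case 0
    then show ?case using bI by (simp add: s_def I_def app_eval_Lam env_ok_def)
  next
    case (Suc i)
    let ?\<rho> = "\<rho>((''m'', NatT) := num H i, (''h'', Baire) := s i)"
    let ?G = "Lam ''n'' NatT (Lam ''r'' NatT (Succ \<cdot> (Var ''h'' Baire \<cdot> Var ''n'' NatT)))"
    have G: "eval H ?\<rho> ?G \<in> carr H (NatT \<Rrightarrow> NatT \<Rrightarrow> NatT)"
      using bF s by (intro eval_carr) (auto simp: F_def env_ok_def)
    have "s (Suc i) = app H (app H (eval H \<rho> F) (num H i)) (s i)" by (simp add: s_def)
    also have "\<dots> = eval H ?\<rho> (Rec NatT \<cdot> (Succ \<cdot> Var ''m'' NatT) \<cdot> ?G)"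
      using bF s by (simp add: F_def app_eval_Lam env_ok_def)
    finally have "app H (s (Suc i)) (num H j) =
        rec_nat (num H (Suc i)) (\<lambda>k r. app H (app H (eval H ?\<rho> ?G) (num H k)) r) j"
      using bF G by (simp add: F_def app_eval_Succ app_eval_Rec)
    also have "\<dots> = num H (max (Suc i) j)"
    \<comment> \<open>The value of the inner step is determined by its index, so a case split on
      \<open>j\<close> replaces a second induction. The recursive value \<open>r\<close> must still
      lie in the carrier for the beta rule to apply to \<open>?G\<close>.\<close>
    proof (cases j)
      case (Suc j')
      define r where "r = rec_nat (num H (Suc i)) (\<lambda>k r. app H (app H (eval H ?\<rho> ?G) (num H k)) r) j'"
      have r: "r \<in> carr H NatT"
        unfolding r_def using bF G by (intro rec_carr) (auto simp: F_def)
      have "app H (app H (eval H ?\<rho> ?G) (num H j')) r = num H (Suc (max i j'))"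
        using bF s r Suc.IH by (simp add: F_def app_eval_Lam env_ok_def app_eval_Succ)
      then show ?thesis by (simp add: Suc r_def)
    qed simp
    finally show ?case .
  qed
  ultimately show ?thesis by simp
qed

text \<open>The bodies of \<open>eta_c\<close> and \<open>kappa_c\<close>, and of the family inside
  \<open>Omega\<close>, are all pairs of abstractions of this shape.\<close>

lemma val_mkJ:
  assumes t: "type_of t = Some NatT" "env_ok H \<rho> (Lam x Baire t)"
    and s: "type_of s = Some NatT" "env_ok H \<rho> (Lam y Baire s)"
    and b: "rank_bounded n (mkJ (Lam x Baire t) (Lam y Baire s))"
  shows "val (eval H \<rho> (mkJ (Lam x Baire t) (Lam y Baire s))) \<alpha> =
      unnum H (eval H (\<rho>((x, Baire) := enc \<alpha>)) t)" (is ?V)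
    and "modl (eval H \<rho> (mkJ (Lam x Baire t) (Lam y Baire s))) \<alpha> =
      unnum H (eval H (\<rho>((y, Baire) := enc \<alpha>)) s)" (is ?M)
proof -
  have r: "rank Baire \<le> n" "rank JN \<le> n"
    using b t s by (auto dest: rank_ArrowD)
  have "eval H \<rho> (Lam x Baire t) \<in> carr H (Baire \<Rrightarrow> NatT)"
    "eval H \<rho> (Lam y Baire s) \<in> carr H (Baire \<Rrightarrow> NatT)"
    using b t s by (auto intro!: eval_carr)
  then show ?V ?M
    using b t s r enc_carr
    by (simp_all add: val_def modl_def app_eval_Mkpair proj_pair app_eval_Lam)
qed

text \<open>\<open>val\<close> and \<open>modl\<close> decode a result. Since that result lies in
  the carrier of \<open>NatT\<close>, encoding it again recovers it.\<close>

lemma eval_JN_comp: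
  assumes "type_of w = Some JN" "env_ok H \<rho> w"
  shows "rank_bounded n (Vcomp w) \<Longrightarrow> app H (eval H \<rho> (Vcomp w)) (enc \<alpha>) = num H (val (eval H \<rho> w) \<alpha>)"
    and "rank_bounded n (Mcomp w) \<Longrightarrow> app H (eval H \<rho> (Mcomp w)) (enc \<alpha>) = num H (modl (eval H \<rho> w) \<alpha>)"
proof -
  assume b: "rank_bounded n (Vcomp w)"
  then have r: "rank JN \<le> n" "rank (Baire \<Rrightarrow> NatT) \<le> n" "rank Baire \<le> n" and w: "eval H \<rho> w \<in> carr H JN"
    using assms by (auto dest: rank_ArrowD intro: eval_carr)
  have "app H (proj1 H (Baire \<Rrightarrow> NatT) (Baire \<Rrightarrow> NatT) (eval H \<rho> w)) (enc \<alpha>) \<in> carr H NatT"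
    by (rule app_carr[OF proj_carr(1)[OF r(1) w] enc_carr[OF r(3)] r(2)])
  then show "app H (eval H \<rho> (Vcomp w)) (enc \<alpha>) = num H (val (eval H \<rho> w) \<alpha>)"
    using b r w by (simp add: app_eval_Pr val_def num_unnum)
next
  assume b: "rank_bounded n (Mcomp w)"
  then have r: "rank JN \<le> n" "rank (Baire \<Rrightarrow> NatT) \<le> n" "rank Baire \<le> n" and w: "eval H \<rho> w \<in> carr H JN"
    using assms by (auto dest: rank_ArrowD intro: eval_carr)
  have "app H (proj2 H (Baire \<Rrightarrow> NatT) (Baire \<Rrightarrow> NatT) (eval H \<rho> w)) (enc \<alpha>) \<in> carr H NatT"
    by (rule app_carr[OF proj_carr(2)[OF r(1) w] enc_carr[OF r(3)] r(2)])
  then show "app H (eval H \<rho> (Mcomp w)) (enc \<alpha>) = num H (modl (eval H \<rho> w) \<alpha>)"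
    using b r w by (simp add: app_eval_Pr modl_def num_unnum)
qed

lemma eta_correct:
  fixes \<rho> :: "string \<times> ty \<Rightarrow> 'v"
  assumes b: "rank_bounded n eta_c"
  defines "w k \<equiv> app H (eval H \<rho> eta_c) (num H k)"
  shows "w k \<in> carr H JN" "val (w k) \<alpha> = k" "modl (w k) \<alpha> = 0"
proof -
  let ?t = "mkJ (Lam ''alpha'' Baire (Var ''n'' NatT)) (Lam ''alpha'' Baire Zero)"
  let ?\<rho> = "\<rho>((''n'', NatT) := num H k)"
  have w: "w k = eval H ?\<rho> ?t"
    unfolding w_def eta_c_def by (rule app_eval_Lam) (use b in \<open>auto simp: eta_c_def env_ok_def\<close>)
  have b': "rank_bounded n ?t" using b by (simp add: eta_c_def)
  show "w k \<in> carr H JN" unfolding w by (rule eval_carr[OF _ b']) (auto simp: env_ok_def)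
  show "val (w k) \<alpha> = k" "modl (w k) \<alpha> = 0"
    unfolding w using b' by ((subst val_mkJ; simp add: env_ok_def), (subst val_mkJ; simp add: env_ok_def))
qed

lemma kappa_correct:
  fixes \<rho> :: "string \<times> ty \<Rightarrow> 'v"
  assumes b: "rank_bounded n kappa_c" and g: "g \<in> carr H (NatT \<Rrightarrow> JN)" and w: "w \<in> carr H JN"
  defines "u \<equiv> app H (app H (eval H \<rho> kappa_c) g) w"
  shows "u \<in> carr H JN" "val u \<alpha> = val (app H g (num H (val w \<alpha>))) \<alpha>"
    "modl u \<alpha> = max (modl (app H g (num H (val w \<alpha>))) \<alpha>) (modl w \<alpha>)"
proof -
  let ?g = "Var ''g'' (NatT \<Rrightarrow> JN)" and ?w = "Var ''w'' JN" and ?\<alpha> = "Var ''alpha'' Baire"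
  let ?x = "?g \<cdot> (Vcomp ?w \<cdot> ?\<alpha>)"
  let ?v = "Vcomp ?x \<cdot> ?\<alpha>" and ?m = "max_tm \<cdot> (Mcomp ?x \<cdot> ?\<alpha>) \<cdot> (Mcomp ?w \<cdot> ?\<alpha>)"
  let ?t = "mkJ (Lam ''alpha'' Baire ?v) (Lam ''alpha'' Baire ?m)"
  let ?\<rho> = "\<rho>((''g'', NatT \<Rrightarrow> JN) := g, (''w'', JN) := w)"
  let ?\<rho>' = "?\<rho>((''alpha'', Baire) := enc \<alpha>)"
  have kappa: "kappa_c = Lam ''g'' (NatT \<Rrightarrow> JN) (Lam ''w'' JN ?t)"
    by (simp add: kappa_c_def Let_def)
  have b': "rank_bounded n ?t" using b by (simp add: kappa)
  have u: "u = eval H ?\<rho> ?t"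
    unfolding u_def kappa
    by (rule app_eval_Lam2) (use b g w in \<open>auto simp: kappa env_ok_def\<close>)
  show "u \<in> carr H JN" unfolding u
    by (rule eval_carr[OF _ b']) (use g w in \<open>auto simp: env_ok_def\<close>)
  have r: "rank Baire \<le> n" using b' by simp
  have ok: "env_ok H ?\<rho>' ?w" "env_ok H ?\<rho>' ?x"
    using g w enc_carr[OF r] by simp_all
  have type_x: "type_of ?x = Some JN" "type_of ?w = Some JN" by simp_all
  have bV: "rank_bounded n (Vcomp ?w)" "rank_bounded n (Vcomp ?x)"
    and bM: "rank_bounded n (Mcomp ?w)" "rank_bounded n (Mcomp ?x)" "rank_bounded n max_tm"
    using b' by simp_all
  have w_eval: "eval H ?\<rho>' ?w = w" and \<alpha>: "eval H ?\<rho>' ?\<alpha> = enc \<alpha>"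
    by simp_all
  \<comment> \<open>This and the following equations unfold one outermost application at a time, so
    that inner applications remain in the form handled by the equations before.\<close>
  have "eval H ?\<rho>' (Vcomp ?w \<cdot> ?\<alpha>) = num H (val w \<alpha>)"
    using eval_JN_comp(1)[OF type_x(2) ok(1) bV(1), of \<alpha>]
    by (simp only: eval.simps(3)[of _ _ "Vcomp ?w"] w_eval \<alpha>)
  then have x: "eval H ?\<rho>' ?x = app H g (num H (val w \<alpha>))"
    by (simp only: eval.simps(3)[of _ _ ?g]) simp
  have v: "eval H ?\<rho>' ?v = num H (val (app H g (num H (val w \<alpha>))) \<alpha>)"
    using eval_JN_comp(1)[OF type_x(1) ok(2) bV(2), of \<alpha>]
    by (simp only: eval.simps(3)[of _ _ "Vcomp ?x"] x \<alpha>)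
  have "eval H ?\<rho>' (Mcomp ?x \<cdot> ?\<alpha>) = num H (modl (app H g (num H (val w \<alpha>))) \<alpha>)"
    using eval_JN_comp(2)[OF type_x(1) ok(2) bM(2), of \<alpha>]
    by (simp only: eval.simps(3)[of _ _ "Mcomp ?x"] x \<alpha>)
  moreover have "eval H ?\<rho>' (Mcomp ?w \<cdot> ?\<alpha>) = num H (modl w \<alpha>)"
    using eval_JN_comp(2)[OF type_x(2) ok(1) bM(1), of \<alpha>]
    by (simp only: eval.simps(3)[of _ _ "Mcomp ?w"] w_eval \<alpha>)
  ultimately have m: "eval H ?\<rho>' ?m = num H (max (modl (app H g (num H (val w \<alpha>))) \<alpha>) (modl w \<alpha>))"
    by (simp only: eval.simps(3)[of _ _ "max_tm \<cdot> (Mcomp ?x \<cdot> ?\<alpha>)"] eval.simps(3)[of _ _ max_tm]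
      eval_max[OF bM(3)])
  have types: "type_of ?v = Some NatT" "type_of ?m = Some NatT" by simp_all
  have oks: "env_ok H ?\<rho> (Lam ''alpha'' Baire ?v)" "env_ok H ?\<rho> (Lam ''alpha'' Baire ?m)"
    using g w by (auto simp: env_ok_def)
  note vm = val_mkJ[OF types(1) oks(1) types(2) oks(2) b', of \<alpha>]
  show "val u \<alpha> = val (app H g (num H (val w \<alpha>))) \<alpha>"
    unfolding u vm v by simp
  show "modl u \<alpha> = max (modl (app H g (num H (val w \<alpha>))) \<alpha>) (modl w \<alpha>)"
    unfolding u vm m by simp
qed

end

section \<open>Typing and free variables of the translation\<close>

lemma continuity_nucleus_sel [simp]:
  "base continuity_nucleus = JN" "eta continuity_nucleus = eta_c" "kappa continuity_nucleus = kappa_c"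
  by (simp_all add: continuity_nucleus_def)

abbreviation Jty :: "ty \<Rightarrow> ty" where
  "Jty \<equiv> J_ty continuity_nucleus"

abbreviation Jtm :: "tm \<Rightarrow> tm" where
  "Jtm \<equiv> J_tm continuity_nucleus"

lemma Jty_neq_NatT: "Jty \<sigma> \<noteq> NatT"
  by (cases \<sigma>) auto

text \<open>\<open>JN\<close> is itself a product, so a translated product might coincide with it;
  its factors would then be \<open>Baire \<Rrightarrow> NatT\<close>. This is excluded because the
  codomain would have to translate to \<open>NatT\<close>.\<close>

lemma Jty_neq_Baire_NatT: "Jty \<sigma> \<noteq> Baire \<Rrightarrow> NatT"
  by (cases \<sigma>) (auto simp: Jty_neq_NatT)

text \<open>Translated variables keep their names, so injectivity on types is what keeps distinct
  variables distinct.\<close>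

lemma Jty_inject [simp]: "Jty \<sigma> = Jty \<tau> \<longleftrightarrow> \<sigma> = \<tau>"
proof (induction \<sigma> arbitrary: \<tau>)
  case NatT
  then show ?case using Jty_neq_Baire_NatT by (cases \<tau>) (auto dest: sym)
next
  case (Arrow \<sigma>1 \<sigma>2)
  then show ?case by (cases \<tau>) auto
next
  case (Times \<sigma>1 \<sigma>2)
  then show ?case using Jty_neq_Baire_NatT by (cases \<tau>) auto
qed

lemma type_of_eta_c [simp]: "type_of eta_c = Some (NatT \<Rrightarrow> JN)"
  by (simp add: eta_c_def)

lemma free_vars_eta_c [simp]: "free_vars eta_c = {}"
  by (simp add: eta_c_def)

lemma type_of_kappa_c [simp]: "type_of kappa_c = Some ((NatT \<Rrightarrow> JN) \<Rrightarrow> JN \<Rrightarrow> JN)"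
  by (simp add: kappa_c_def Let_def)

lemma free_vars_kappa_c [simp]: "free_vars kappa_c = {}"
  by (auto simp: kappa_c_def Let_def)

lemma type_of_ke [simp]:
  "type_of (ke continuity_nucleus \<sigma>) = Some ((NatT \<Rrightarrow> Jty \<sigma>) \<Rrightarrow> JN \<Rrightarrow> Jty \<sigma>)"
  by (induction \<sigma>) (simp_all add: Let_def)

lemma free_vars_ke [simp]: "free_vars (ke continuity_nucleus \<sigma>) = {}"
  by (induction \<sigma>) (auto simp: Let_def)

lemma type_of_Jtm: "type_of t = Some \<tau> \<Longrightarrow> type_of (Jtm t) = Some (Jty \<tau>)"
proof (induction t arbitrary: \<tau>)
  case (App t u)
  then obtain \<sigma> where "type_of t = Some (\<sigma> \<Rrightarrow> \<tau>)" "type_of u = Some \<sigma>"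
    by (auto simp: type_of_App_Some simp del: type_of.simps)
  with App.IH show ?case by simp
qed (auto simp: Let_def)

lemma free_vars_Jtm: "free_vars (Jtm t) = map_prod id Jty ` free_vars t"
proof (induction t)
  case (Lam x \<sigma> t)
  \<comment> \<open>Removing the bound variable commutes with taking the image, by injectivity of
    the renaming.\<close>
  have "inj (map_prod id Jty :: string \<times> ty \<Rightarrow> _)" by (auto intro!: injI)
  from image_set_diff[OF this, of "free_vars t" "{(x, \<sigma>)}"] show ?case by (simp add: Lam id_def)
qed (auto simp: Let_def)

section \<open>The logical relation and its fundamental lemma\<close>

context finite_types
begin

text \<open>At base type \<open>\<alpha>\<close> enters through the equation of values, while the
  modulus clause ranges over all sequences. Carrier membership is built in at every type, since an
  arbitrary element of the value type need not code anything.\<close>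

primrec rel :: "(nat \<Rightarrow> nat) \<Rightarrow> ty \<Rightarrow> 'v \<Rightarrow> 'v \<Rightarrow> bool" where
  "rel \<alpha> NatT w m \<longleftrightarrow> w \<in> carr H JN \<and> m \<in> carr H NatT \<and>
     val w \<alpha> = unnum H m \<and> modulus_of_continuity (modl w) (val w)"
| "rel \<alpha> (\<sigma> \<Rrightarrow> \<tau>) u v \<longleftrightarrow> u \<in> carr H (Jty (\<sigma> \<Rrightarrow> \<tau>)) \<and> v \<in> carr H (\<sigma> \<Rrightarrow> \<tau>) \<and>
     (\<forall>x y. rel \<alpha> \<sigma> x y \<longrightarrow> rel \<alpha> \<tau> (app H u x) (app H v y))"
| "rel \<alpha> (\<sigma> \<otimes> \<tau>) p q \<longleftrightarrow> p \<in> carr H (Jty (\<sigma> \<otimes> \<tau>)) \<and> q \<in> carr H (\<sigma> \<otimes> \<tau>) \<and>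
     rel \<alpha> \<sigma> (proj1 H (Jty \<sigma>) (Jty \<tau>) p) (proj1 H \<sigma> \<tau> q) \<and>
     rel \<alpha> \<tau> (proj2 H (Jty \<sigma>) (Jty \<tau>) p) (proj2 H \<sigma> \<tau> q)"

lemma rel_carr:
  assumes "rel \<alpha> \<sigma> x y"
  shows "x \<in> carr H (Jty \<sigma>)" "y \<in> carr H \<sigma>"
  using assms by (cases \<sigma>; simp)+

lemma rel_app: "rel \<alpha> (\<sigma> \<Rrightarrow> \<tau>) u v \<Longrightarrow> rel \<alpha> \<sigma> x y \<Longrightarrow> rel \<alpha> \<tau> (app H u x) (app H v y)"
  by simp

lemma rel_ArrowI:
  assumes "u \<in> carr H (Jty \<sigma> \<Rrightarrow> Jty \<tau>)" "v \<in> carr H (\<sigma> \<Rrightarrow> \<tau>)"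
    and "\<And>x y. rel \<alpha> \<sigma> x y \<Longrightarrow> rel \<alpha> \<tau> (app H u x) (app H v y)"
  shows "rel \<alpha> (\<sigma> \<Rrightarrow> \<tau>) u v"
  using assms by simp

text \<open>The value component is constant, so 0 is a modulus.\<close>

lemma rel_eta: "rank_bounded n eta_c \<Longrightarrow> rel \<alpha> NatT (app H (eval H \<rho> eta_c) (num H k)) (num H k)"
  by (simp add: eta_correct modulus_of_continuity_def)

text \<open>At a sequence \<open>\<beta>\<close> the modulus of the result consults \<open>g\<close>
  at \<open>val w \<beta>\<close>, which can be any number. Hence the modulus hypothesis on
  \<open>g\<close> covers all \<open>k\<close>, whereas values are compared at the single index
  \<open>m\<close>.\<close>

lemma rel_kappa:
  assumes "rank_bounded n kappa_c" "g \<in> carr H (NatT \<Rrightarrow> JN)" "rel \<alpha> NatT w m"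
    and g: "\<And>k. modulus_of_continuity (modl (app H g (num H k))) (val (app H g (num H k)))"
    and h: "h \<in> carr H NatT" "val (app H g m) \<alpha> = unnum H h"
  shows "rel \<alpha> NatT (app H (app H (eval H \<rho> kappa_c) g) w) h"
proof -
  have w: "w \<in> carr H JN" "m = num H (val w \<alpha>)" "modulus_of_continuity (modl w) (val w)"
    using assms(3) by (simp_all add: num_unnum)
  note kappa = kappa_correct[OF assms(1,2) w(1)]
  have "modulus_of_continuity (modl (app H (app H (eval H \<rho> kappa_c) g) w))
      (val (app H (app H (eval H \<rho> kappa_c) g) w))"
    unfolding modulus_of_continuity_def
  proof (intro allI impI)
    fix \<beta> \<gamma> :: "nat \<Rightarrow> nat"
    assume "\<forall>i<modl (app H (app H (eval H \<rho> kappa_c) g) w) \<beta>. \<beta> i = \<gamma> i"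
    then have "\<forall>i<modl w \<beta>. \<beta> i = \<gamma> i" "\<forall>i<modl (app H g (num H (val w \<beta>))) \<beta>. \<beta> i = \<gamma> i"
      by (simp_all add: kappa)
    with w(3) g have "val w \<beta> = val w \<gamma>"
      "val (app H g (num H (val w \<beta>))) \<beta> = val (app H g (num H (val w \<beta>))) \<gamma>"
      unfolding modulus_of_continuity_def by blast+
    then show "val (app H (app H (eval H \<rho> kappa_c) g) w) \<beta> =
        val (app H (app H (eval H \<rho> kappa_c) g) w) \<gamma>"
      by (simp add: kappa)
  qed
  with h w(2) show ?thesis by (simp add: kappa)
qed

text \<open>Relatedness at numerals extends to all related arguments, by recursion on the type as in
  \<open>ke\<close>. Taking \<open>h\<close> as a HOL function lets the recursive calls use
  \<open>\<lambda>k. app H (h k) y\<close> or projections of \<open>h k\<close> without coding them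
  in the hierarchy.\<close>

lemma rel_ke:
  assumes "rank_bounded n (ke continuity_nucleus \<sigma>)" "g \<in> carr H (NatT \<Rrightarrow> Jty \<sigma>)"
    and "\<And>k. rel \<alpha> \<sigma> (app H g (num H k)) (h k)" "rel \<alpha> NatT w m"
  shows "rel \<alpha> \<sigma> (app H (app H (eval H \<rho> (ke continuity_nucleus \<sigma>)) g) w) (h (unnum H m))"
  using assms
proof (induction \<sigma> arbitrary: g h \<rho>)
  case NatT
  \<comment> \<open>The third premise speaks of numerals, \<open>rel_kappa\<close> of
    \<open>m\<close> itself.\<close>
  have m: "num H (unnum H m) = m" using NatT.prems(4) by (simp add: num_unnum)
  show ?case unfolding ke.simps continuity_nucleus_sel
    by (rule rel_kappa[OF _ _ NatT.prems(4)])
      (use NatT.prems(1-3) NatT.prems(3)[of "unnum H m"] m in auto)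
next
  case (Arrow \<sigma> \<tau>)
  let ?S = "Jty \<sigma>" and ?T = "Jty \<tau>"
  let ?G = "NatT \<Rrightarrow> ?S \<Rrightarrow> ?T"
  let ?k = "Lam ''n'' NatT (Var ''g'' ?G \<cdot> Var ''n'' NatT \<cdot> Var ''x'' ?S)"
  let ?b = "ke continuity_nucleus \<tau> \<cdot> ?k \<cdot> Var ''a'' JN"
  have ke: "ke continuity_nucleus (\<sigma> \<Rrightarrow> \<tau>) = Lam ''g'' ?G (Lam ''a'' JN (Lam ''x'' ?S ?b))"
    by (simp add: Let_def)
  note b = Arrow.prems(1)[unfolded ke]
  have g: "g \<in> carr H ?G" using Arrow.prems(2) by simp
  have w: "w \<in> carr H JN" using Arrow.prems(4) by simp
  let ?u = "app H (app H (eval H \<rho> (ke continuity_nucleus (\<sigma> \<Rrightarrow> \<tau>))) g) w"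
  let ?\<rho> = "\<rho>((''g'', ?G) := g, (''a'', JN) := w)"
  have u: "?u = eval H ?\<rho> (Lam ''x'' ?S ?b)"
    unfolding ke by (rule app_eval_Lam2) (use b g w in \<open>auto simp: env_ok_def\<close>)
  have "?u \<in> carr H (?S \<Rrightarrow> ?T)"
    unfolding u by (rule eval_carr) (use b g w in \<open>auto simp: env_ok_def\<close>)
  moreover have "h (unnum H m) \<in> carr H (\<sigma> \<Rrightarrow> \<tau>)" using Arrow.prems(3) rel_carr by blast
  moreover have "rel \<alpha> \<tau> (app H ?u x) (app H (h (unnum H m)) y)" if "rel \<alpha> \<sigma> x y" for x y
  proof -
    let ?\<rho>' = "?\<rho>((''x'', ?S) := x)"
    have x: "x \<in> carr H ?S" using that by (rule rel_carr)
    have ux: "app H ?u x = app H (app H (eval H ?\<rho>' (ke continuity_nucleus \<tau>)) (eval H ?\<rho>' ?k)) w"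
      unfolding u by (subst app_eval_Lam) (use b g w x in \<open>auto simp: env_ok_def\<close>)
    show ?thesis
      unfolding ux
    \<comment> \<open>The recursive call receives the family sending \<open>n\<close> to
      \<open>g n x\<close>, denoted by \<open>?k\<close>; on the other side each \<open>h k\<close>
      is applied to \<open>y\<close>.\<close>
    proof (rule Arrow.IH(2)[of "eval H ?\<rho>' ?k" "\<lambda>k. app H (h k) y"])
      show "rank_bounded n (ke continuity_nucleus \<tau>)" using b by simp
      show "eval H ?\<rho>' ?k \<in> carr H (NatT \<Rrightarrow> ?T)"
        by (rule eval_carr) (use b g w x in \<open>auto simp: env_ok_def\<close>)
      fix k
      have "app H (eval H ?\<rho>' ?k) (num H k) = app H (app H g (num H k)) x"
        by (subst app_eval_Lam) (use b g w x in \<open>auto simp: env_ok_def\<close>)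
      then show "rel \<alpha> \<tau> (app H (eval H ?\<rho>' ?k) (num H k)) (app H (h k) y)"
        using Arrow.prems(3)[of k] that by simp
    qed (rule Arrow.prems(4))
  qed
  ultimately show ?case by simp
next
  case (Times \<sigma> \<tau>)
  let ?S = "Jty \<sigma>" and ?T = "Jty \<tau>"
  let ?G = "NatT \<Rrightarrow> ?S \<otimes> ?T"
  let ?k1 = "Lam ''n'' NatT (Pr1 ?S ?T \<cdot> (Var ''g'' ?G \<cdot> Var ''n'' NatT))"
  let ?k2 = "Lam ''n'' NatT (Pr2 ?S ?T \<cdot> (Var ''g'' ?G \<cdot> Var ''n'' NatT))"
  let ?b1 = "ke continuity_nucleus \<sigma> \<cdot> ?k1 \<cdot> Var ''a'' JN"
  let ?b2 = "ke continuity_nucleus \<tau> \<cdot> ?k2 \<cdot> Var ''a'' JN"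
  let ?b = "Mkpair ?S ?T \<cdot> ?b1 \<cdot> ?b2"
  have ke: "ke continuity_nucleus (\<sigma> \<otimes> \<tau>) = Lam ''g'' ?G (Lam ''a'' JN ?b)"
    by (simp add: Let_def)
  note b = Times.prems(1)[unfolded ke]
  have r: "rank (?S \<otimes> ?T) \<le> n" using b by (auto dest: rank_ArrowD)
  have g: "g \<in> carr H ?G" using Times.prems(2) by simp
  have w: "w \<in> carr H JN" using Times.prems(4) by simp
  let ?u = "app H (app H (eval H \<rho> (ke continuity_nucleus (\<sigma> \<otimes> \<tau>))) g) w"
  let ?\<rho> = "\<rho>((''g'', ?G) := g, (''a'', JN) := w)"
  have u: "?u = eval H ?\<rho> ?b"
    unfolding ke by (rule app_eval_Lam2) (use b g w in \<open>auto simp: env_ok_def\<close>)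
  have "?u \<in> carr H (?S \<otimes> ?T)"
    unfolding u by (rule eval_carr) (use b g w in \<open>auto simp: env_ok_def\<close>)
  moreover have "h (unnum H m) \<in> carr H (\<sigma> \<otimes> \<tau>)" using Times.prems(3) rel_carr by blast
  moreover have b12: "eval H ?\<rho> ?b1 \<in> carr H ?S" "eval H ?\<rho> ?b2 \<in> carr H ?T"
    by (rule eval_carr; use b g w in \<open>auto simp: env_ok_def\<close>)+
  \<comment> \<open>Once \<open>?u\<close> is displayed as a pair, its projections are the values of
    \<open>?b1\<close> and \<open>?b2\<close>, and each is handled by one induction
    hypothesis.\<close>
  have u_pair: "?u = pair H ?S ?T (eval H ?\<rho> ?b1) (eval H ?\<rho> ?b2)"
    unfolding u using b by (subst eval.simps(3), subst eval.simps(3), intro app_eval_Mkpair b12) auto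
  have gk: "app H g (num H k) \<in> carr H (?S \<otimes> ?T)" for k
    by (rule app_carr[OF g]) (use b in auto)
  have "rel \<alpha> \<sigma> (eval H ?\<rho> ?b1) (proj1 H \<sigma> \<tau> (h (unnum H m)))"
  proof -
    have "rel \<alpha> \<sigma> (app H (app H (eval H ?\<rho> (ke continuity_nucleus \<sigma>)) (eval H ?\<rho> ?k1)) w)
        (proj1 H \<sigma> \<tau> (h (unnum H m)))"
    proof (rule Times.IH(1)[of "eval H ?\<rho> ?k1" "\<lambda>k. proj1 H \<sigma> \<tau> (h k)"])
      show "rank_bounded n (ke continuity_nucleus \<sigma>)" using b by simp
      show "eval H ?\<rho> ?k1 \<in> carr H (NatT \<Rrightarrow> ?S)"
        by (rule eval_carr) (use b g w in \<open>auto simp: env_ok_def\<close>)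
      fix k
      have "app H (eval H ?\<rho> ?k1) (num H k) = proj1 H ?S ?T (app H g (num H k))"
        by (subst app_eval_Lam) (use b g gk r in \<open>auto simp: env_ok_def app_eval_Pr\<close>)
      then show "rel \<alpha> \<sigma> (app H (eval H ?\<rho> ?k1) (num H k)) (proj1 H \<sigma> \<tau> (h k))"
        using Times.prems(3)[of k] by simp
    qed (rule Times.prems(4))
    then show ?thesis by simp
  qed
  moreover have "rel \<alpha> \<tau> (eval H ?\<rho> ?b2) (proj2 H \<sigma> \<tau> (h (unnum H m)))"
  proof -
    have "rel \<alpha> \<tau> (app H (app H (eval H ?\<rho> (ke continuity_nucleus \<tau>)) (eval H ?\<rho> ?k2)) w)
        (proj2 H \<sigma> \<tau> (h (unnum H m)))"
    proof (rule Times.IH(2)[of "eval H ?\<rho> ?k2" "\<lambda>k. proj2 H \<sigma> \<tau> (h k)"])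
      show "rank_bounded n (ke continuity_nucleus \<tau>)" using b by simp
      show "eval H ?\<rho> ?k2 \<in> carr H (NatT \<Rrightarrow> ?T)"
        by (rule eval_carr) (use b g w in \<open>auto simp: env_ok_def\<close>)
      fix k
      have "app H (eval H ?\<rho> ?k2) (num H k) = proj2 H ?S ?T (app H g (num H k))"
        by (subst app_eval_Lam) (use b g gk r in \<open>auto simp: env_ok_def app_eval_Pr\<close>)
      then show "rel \<alpha> \<tau> (app H (eval H ?\<rho> ?k2) (num H k)) (proj2 H \<sigma> \<tau> (h k))"
        using Times.prems(3)[of k] by simp
    qed (rule Times.prems(4))
    then show ?thesis by simp
  qed
  ultimately show ?case
    unfolding rel.simps(3) by (simp only: u_pair proj_pair[OF r b12] J_ty.simps)
qed

text \<open>At numerals the two recursors unfold in step and stay related by induction;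
  \<open>rel_ke\<close> then passes from numerals to arbitrary elements of
  \<open>JN\<close>.\<close>

lemma rel_Jtm_Rec:
  assumes b: "rank_bounded n (Rec \<sigma>)" and bJ: "rank_bounded n (Jtm (Rec \<sigma>))"
  shows "rel \<alpha> (\<sigma> \<Rrightarrow> (NatT \<Rrightarrow> \<sigma> \<Rrightarrow> \<sigma>) \<Rrightarrow> NatT \<Rrightarrow> \<sigma>)
    (eval H \<rho>' (Jtm (Rec \<sigma>))) (eval H \<rho> (Rec \<sigma>))"
proof -
  let ?S = "Jty \<sigma>"
  let ?F = "JN \<Rrightarrow> ?S \<Rrightarrow> ?S"
  let ?k = "Lam ''n'' NatT (Var ''f'' ?F \<cdot> (eta_c \<cdot> Var ''n'' NatT))"
  let ?r = "Rec ?S \<cdot> Var ''x'' ?S \<cdot> ?k"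
  let ?b = "ke continuity_nucleus \<sigma> \<cdot> ?r"
  have J: "Jtm (Rec \<sigma>) = Lam ''x'' ?S (Lam ''f'' ?F ?b)" by (simp add: Let_def)
  note bJ = bJ[unfolded J]
  let ?v = "eval H \<rho> (Rec \<sigma>)"
  have u: "eval H \<rho>' (Lam ''x'' ?S (Lam ''f'' ?F ?b)) \<in> carr H (?S \<Rrightarrow> ?F \<Rrightarrow> JN \<Rrightarrow> ?S)"
    by (rule eval_carr) (use bJ in \<open>auto simp: env_ok_def\<close>)
  have v: "?v \<in> carr H (\<sigma> \<Rrightarrow> (NatT \<Rrightarrow> \<sigma> \<Rrightarrow> \<sigma>) \<Rrightarrow> NatT \<Rrightarrow> \<sigma>)"
    by (rule eval_carr) (use b in auto)
  have "rel \<alpha> ((NatT \<Rrightarrow> \<sigma> \<Rrightarrow> \<sigma>) \<Rrightarrow> NatT \<Rrightarrow> \<sigma>)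
      (app H (eval H \<rho>' (Lam ''x'' ?S (Lam ''f'' ?F ?b))) x) (app H ?v y)" if xy: "rel \<alpha> \<sigma> x y" for x y
  proof -
    note x = rel_carr(1)[OF xy] and y = rel_carr(2)[OF xy]
    let ?\<rho>x = "\<rho>'((''x'', ?S) := x)"
    have ux: "app H (eval H \<rho>' (Lam ''x'' ?S (Lam ''f'' ?F ?b))) x = eval H ?\<rho>x (Lam ''f'' ?F ?b)"
      by (rule app_eval_Lam) (use bJ x in \<open>auto simp: env_ok_def\<close>)
    have uxc: "eval H ?\<rho>x (Lam ''f'' ?F ?b) \<in> carr H (?F \<Rrightarrow> JN \<Rrightarrow> ?S)"
      by (rule eval_carr) (use bJ x in \<open>auto simp: env_ok_def\<close>)
    have vyc: "app H ?v y \<in> carr H ((NatT \<Rrightarrow> \<sigma> \<Rrightarrow> \<sigma>) \<Rrightarrow> NatT \<Rrightarrow> \<sigma>)"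
      by (rule app_carr[OF v y]) (use b in auto)
    have "rel \<alpha> (NatT \<Rrightarrow> \<sigma>) (app H (eval H ?\<rho>x (Lam ''f'' ?F ?b)) f) (app H (app H ?v y) g)"
      if fg: "rel \<alpha> (NatT \<Rrightarrow> \<sigma> \<Rrightarrow> \<sigma>) f g" for f g
    proof -
      have f: "f \<in> carr H ?F" and g: "g \<in> carr H (NatT \<Rrightarrow> \<sigma> \<Rrightarrow> \<sigma>)"
        using rel_carr[OF fg] by simp_all
      let ?\<rho>f = "?\<rho>x((''f'', ?F) := f)"
      have uxf: "app H (eval H ?\<rho>x (Lam ''f'' ?F ?b)) f = eval H ?\<rho>f ?b"
        by (rule app_eval_Lam) (use bJ x f in \<open>auto simp: env_ok_def\<close>)
      have uxfc: "eval H ?\<rho>f ?b \<in> carr H (JN \<Rrightarrow> ?S)"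
        by (rule eval_carr) (use bJ x f in \<open>auto simp: env_ok_def\<close>)
      have vygc: "app H (app H ?v y) g \<in> carr H (NatT \<Rrightarrow> \<sigma>)"
        by (rule app_carr[OF vyc g]) (use b in \<open>auto dest: rank_ArrowD\<close>)
      \<comment> \<open>The values of the ordinary recursor at numerals, in the form that
        \<open>rel_ke\<close> expects.\<close>
      define h where "h k = rec_nat y (\<lambda>k r. app H (app H g (num H k)) r) k" for k
      have vk: "app H (app H (app H ?v y) g) (num H k) = h k" for k
        unfolding h_def by (rule app_eval_Rec) (use b y g in auto)
      have kc: "eval H ?\<rho>f ?k \<in> carr H (NatT \<Rrightarrow> ?S \<Rrightarrow> ?S)"
        by (rule eval_carr) (use bJ x f in \<open>auto simp: env_ok_def\<close>)
      have r: "rel \<alpha> \<sigma> (app H (eval H ?\<rho>f ?r) (num H k)) (h k)" for k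
      proof -
        \<comment> \<open>\<open>K\<close> is \<open>f\<close> composed with \<open>eta_c\<close>.
          Since \<open>rel_eta\<close> relates \<open>eta_c\<close> at a numeral to that numeral,
          \<open>K\<close> and \<open>g\<close> have related values at numerals.\<close>
        define K where "K = eval H ?\<rho>f ?k"
        have K: "rel \<alpha> (\<sigma> \<Rrightarrow> \<sigma>) (app H K (num H k)) (app H g (num H k))" for k
        proof -
          have "app H K (num H k) =
              app H f (app H (eval H (?\<rho>f((''n'', NatT) := num H k)) eta_c) (num H k))"
            unfolding K_def by (subst app_eval_Lam) (use bJ x f in \<open>auto simp: env_ok_def\<close>)
          then show ?thesis using rel_app[OF fg rel_eta] bJ by (simp del: rel.simps)
        qed
        have "app H (eval H ?\<rho>f ?r) (num H k) = rec_nat x (\<lambda>k r. app H (app H K (num H k)) r) k"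
          using app_eval_Rec[OF _ x kc] bJ by (simp add: K_def)
        moreover have "rel \<alpha> \<sigma> (rec_nat x (\<lambda>k r. app H (app H K (num H k)) r) k) (h k)"
        proof (induction k)
          case 0
          then show ?case using xy by (simp add: h_def)
        next
          case (Suc k)
          show ?case using rel_app[OF K Suc.IH] by (simp add: h_def)
        qed
        ultimately show ?thesis by simp
      qed
      have rc: "eval H ?\<rho>f ?r \<in> carr H (NatT \<Rrightarrow> ?S)"
        by (rule eval_carr) (use bJ x f in \<open>auto simp: env_ok_def\<close>)
      have "rel \<alpha> \<sigma> (app H (eval H ?\<rho>f ?b) w) (app H (app H (app H ?v y) g) m)"
        if wm: "rel \<alpha> NatT w m" for w m
      proof -
        have m: "num H (unnum H m) = m" using rel_carr(2)[OF wm] by (simp add: num_unnum)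
        have "rel \<alpha> \<sigma> (app H (app H (eval H ?\<rho>f (ke continuity_nucleus \<sigma>)) (eval H ?\<rho>f ?r)) w) (h (unnum H m))"
          by (rule rel_ke[OF _ rc r wm]) (use bJ in simp)
        then show ?thesis using vk[of "unnum H m"] unfolding m by simp
      qed
      with uxfc vygc show ?thesis unfolding uxf by (intro rel_ArrowI) simp_all
    qed
    note step = this
    show ?thesis
      unfolding ux by (rule rel_ArrowI[OF _ vyc step]) (use uxc in simp)
  qed
  note step = this
  show ?thesis unfolding J by (rule rel_ArrowI[OF _ v step]) (use u in simp)
qed

text \<open>Translation raises ranks, \<open>JN\<close> already having rank 3, so \<open>t\<close>
  and \<open>Jtm t\<close> are bounded by separate hypotheses.\<close>

lemma rel_Jtm:
  "type_of t = Some \<tau> \<Longrightarrow> rank_bounded n t \<Longrightarrow> rank_bounded n (Jtm t) \<Longrightarrow>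
    (\<And>x \<sigma>. (x, \<sigma>) \<in> free_vars t \<Longrightarrow> rel \<alpha> \<sigma> (\<rho>' (x, Jty \<sigma>)) (\<rho> (x, \<sigma>))) \<Longrightarrow>
    rel \<alpha> \<tau> (eval H \<rho>' (Jtm t)) (eval H \<rho> t)"
proof (induction t arbitrary: \<tau> \<rho> \<rho>')
  case (Var x \<sigma>)
  then show ?case by simp
next
  case (Lam x \<sigma> t)
  then obtain \<tau>' where t: "type_of t = Some \<tau>'" "\<tau> = \<sigma> \<Rrightarrow> \<tau>'" by auto
  have env: "env_ok H \<rho> (Lam x \<sigma> t)"
    using Lam.prems(4) rel_carr unfolding env_ok_def by blast
  have env': "env_ok H \<rho>' (Lam x (Jty \<sigma>) (Jtm t))"
    using Lam.prems(4) rel_carr unfolding env_ok_def by (fastforce simp: free_vars_Jtm)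
  have "eval H \<rho> (Lam x \<sigma> t) \<in> carr H \<tau>"
    using Lam.prems env by (intro eval_carr)
  moreover have "eval H \<rho>' (Lam x (Jty \<sigma>) (Jtm t)) \<in> carr H (Jty \<tau>)"
    using Lam.prems(3) env' t by (intro eval_carr) (auto simp: type_of_Jtm)
  moreover have "rel \<alpha> \<tau>' (app H (eval H \<rho>' (Lam x (Jty \<sigma>) (Jtm t))) a)
      (app H (eval H \<rho> (Lam x \<sigma> t)) b)" if ab: "rel \<alpha> \<sigma> a b" for a b
  proof -
    have "app H (eval H \<rho> (Lam x \<sigma> t)) b = eval H (\<rho>((x, \<sigma>) := b)) t"
      using t(1) Lam.prems(2) env rel_carr(2)[OF ab] by (rule app_eval_Lam)
    moreover have "app H (eval H \<rho>' (Lam x (Jty \<sigma>) (Jtm t))) a = eval H (\<rho>'((x, Jty \<sigma>) := a)) (Jtm t)"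
      using type_of_Jtm[OF t(1)] _ env' rel_carr(1)[OF ab]
      by (rule app_eval_Lam) (use Lam.prems(3) in simp)
    \<comment> \<open>By injectivity of \<open>Jty\<close> the two updates affect corresponding
      variables only, so the updated environments are again related on the free variables of
      \<open>t\<close>.\<close>
    moreover have "rel \<alpha> \<tau>' (eval H (\<rho>'((x, Jty \<sigma>) := a)) (Jtm t)) (eval H (\<rho>((x, \<sigma>) := b)) t)"
      using t(1) Lam.prems ab by (intro Lam.IH) auto
    ultimately show ?thesis by simp
  qed
  ultimately show ?case by (simp add: t(2))
next
  case (App t u)
  then obtain \<sigma> where "type_of t = Some (\<sigma> \<Rrightarrow> \<tau>)" "type_of u = Some \<sigma>"
    by (auto simp: type_of_App_Some simp del: type_of.simps)
  then have "rel \<alpha> (\<sigma> \<Rrightarrow> \<tau>) (eval H \<rho>' (Jtm t)) (eval H \<rho> t)" "rel \<alpha> \<sigma> (eval H \<rho>' (Jtm u)) (eval H \<rho> u)"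
    using App.prems by (auto intro!: App.IH simp del: rel.simps)
  then show ?case by simp
next
  case Zero
  then show ?case using rel_eta[of \<alpha> \<rho>' 0] by simp
next
  case Succ
  \<comment> \<open>\<open>?k\<close> is \<open>eta_c\<close> after the successor. At the numeral
    \<open>k\<close> it is related to the numeral \<open>Suc k\<close>, and \<open>rel_kappa\<close>
    extends this to all related arguments.\<close>
  let ?k = "Lam ''n'' NatT (eta_c \<cdot> (Succ \<cdot> Var ''n'' NatT))"
  have b: "rank_bounded n (kappa_c \<cdot> ?k)" and r: "rank Baire \<le> n" using Succ by simp_all
  have k: "eval H \<rho>' ?k \<in> carr H (NatT \<Rrightarrow> JN)"
    by (rule eval_carr) (use b in \<open>auto simp: env_ok_def\<close>)
  have kk: "app H (eval H \<rho>' ?k) (num H k) =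
      app H (eval H (\<rho>'((''n'', NatT) := num H k)) eta_c) (num H (Suc k))" for k
    by (subst app_eval_Lam) (use b r in \<open>auto simp: env_ok_def app_eval_Succ\<close>)
  have "eval H \<rho>' (kappa_c \<cdot> ?k) \<in> carr H (JN \<Rrightarrow> JN)"
    by (rule eval_carr) (use b in \<open>auto simp: env_ok_def\<close>)
  moreover have "eval H \<rho> Succ \<in> carr H Baire"
    by (rule eval_carr) (use r in auto)
  moreover have "rel \<alpha> NatT (app H (app H (eval H \<rho>' kappa_c) (eval H \<rho>' ?k)) w) (app H (eval H \<rho> Succ) m)"
    if wm: "rel \<alpha> NatT w m" for w m
  proof -
    have m: "m = num H (unnum H m)" using rel_carr(2)[OF wm] by (simp add: num_unnum)
    have "rel \<alpha> NatT (app H (eval H \<rho>' ?k) (num H k)) (num H (Suc k))" for k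
      unfolding kk by (rule rel_eta) (use b in simp)
    note k_rel = this
    show ?thesis
      by (subst m, subst app_eval_Succ[OF r], rule rel_kappa[OF _ k wm])
        (use b k_rel k_rel[of "unnum H m"] m in auto)
  qed
  moreover have "\<tau> = Baire" using Succ.prems(1) by simp
  ultimately show ?case by (simp del: rel.simps(1))
next
  case (Rec \<sigma>)
  then have "\<tau> = \<sigma> \<Rrightarrow> (NatT \<Rrightarrow> \<sigma> \<Rrightarrow> \<sigma>) \<Rrightarrow> NatT \<Rrightarrow> \<sigma>" by simp
  with rel_Jtm_Rec[OF Rec.prems(2,3)] show ?case by (simp only:)
next
  case (Mkpair \<sigma> \<tau>')
  let ?S = "Jty \<sigma>" and ?T = "Jty \<tau>'"
  let ?u = "eval H \<rho>' (Mkpair ?S ?T)" and ?v = "eval H \<rho> (Mkpair \<sigma> \<tau>')"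
  have b: "rank (\<sigma> \<Rrightarrow> \<tau>' \<Rrightarrow> \<sigma> \<otimes> \<tau>') \<le> n" and b': "rank (?S \<Rrightarrow> ?T \<Rrightarrow> ?S \<otimes> ?T) \<le> n"
    using Mkpair.prems by simp_all
  note r = b b[THEN rank_ArrowD(2)] b[THEN rank_ArrowD(2), THEN rank_ArrowD(2)]
    b' b'[THEN rank_ArrowD(2)] b'[THEN rank_ArrowD(2), THEN rank_ArrowD(2)]
  have u: "?u \<in> carr H (?S \<Rrightarrow> ?T \<Rrightarrow> ?S \<otimes> ?T)" and v: "?v \<in> carr H (\<sigma> \<Rrightarrow> \<tau>' \<Rrightarrow> \<sigma> \<otimes> \<tau>')"
    using b b' by (auto intro!: eval_carr)
  have "rel \<alpha> (\<sigma> \<otimes> \<tau>') (app H (app H ?u x) x') (app H (app H ?v y) y')"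
    if "rel \<alpha> \<sigma> x y" "rel \<alpha> \<tau>' x' y'" for x y x' y'
    using that r rel_carr[OF that(1)] rel_carr[OF that(2)]
    by (simp add: app_eval_Mkpair pair_carr proj_pair)
  \<comment> \<open>The arrow clause of \<open>rel\<close> also demands that the partial
    applications lie in the carriers.\<close>
  moreover have "app H ?u x \<in> carr H (?T \<Rrightarrow> ?S \<otimes> ?T)" "app H ?v y \<in> carr H (\<tau>' \<Rrightarrow> \<sigma> \<otimes> \<tau>')"
    if "rel \<alpha> \<sigma> x y" for x y
    using app_carr[OF u] app_carr[OF v] rel_carr[OF that] r by blast+
  ultimately show ?case using Mkpair.prems(1) u v by auto
next
  case (Pr1 \<sigma> \<tau>')
  let ?S = "Jty \<sigma>" and ?T = "Jty \<tau>'"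
  have b: "rank (\<sigma> \<otimes> \<tau>' \<Rrightarrow> \<sigma>) \<le> n" "rank (?S \<otimes> ?T \<Rrightarrow> ?S) \<le> n"
    using Pr1.prems by simp_all
  note r = b b[THEN rank_ArrowD(1)]
  have "eval H \<rho>' (Pr1 ?S ?T) \<in> carr H (?S \<otimes> ?T \<Rrightarrow> ?S)" "eval H \<rho> (Pr1 \<sigma> \<tau>') \<in> carr H (\<sigma> \<otimes> \<tau>' \<Rrightarrow> \<sigma>)"
    using b by (auto intro!: eval_carr)
  then show ?case using Pr1.prems(1) r by (auto simp: app_eval_Pr)
next
  case (Pr2 \<sigma> \<tau>')
  let ?S = "Jty \<sigma>" and ?T = "Jty \<tau>'"
  have b: "rank (\<sigma> \<otimes> \<tau>' \<Rrightarrow> \<tau>') \<le> n" "rank (?S \<otimes> ?T \<Rrightarrow> ?T) \<le> n"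
    using Pr2.prems by simp_all
  note r = b b[THEN rank_ArrowD(1)]
  have "eval H \<rho>' (Pr2 ?S ?T) \<in> carr H (?S \<otimes> ?T \<Rrightarrow> ?T)" "eval H \<rho> (Pr2 \<sigma> \<tau>') \<in> carr H (\<sigma> \<otimes> \<tau>' \<Rrightarrow> \<tau>')"
    using b by (auto intro!: eval_carr)
  then show ?case using Pr2.prems(1) r by (auto simp: app_eval_Pr)
qed

section \<open>The generic sequence and the modulus theorem\<close>

lemma type_of_Omega: "type_of Omega = Some (JN \<Rrightarrow> JN)"
  by (simp add: Omega_def Let_def)

lemma free_vars_Omega: "free_vars Omega = {}"
  by (auto simp: Omega_def Let_def)

text \<open>\<open>Omega\<close> is a generic sequence: one term, related to every
  \<open>\<alpha>\<close>. Applied to \<open>w\<close>, it selects the member of its family at index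
  \<open>val w \<alpha>\<close>, and the member at index \<open>i\<close> evaluates a sequence at
  \<open>i\<close>.\<close>

lemma rel_Omega:
  assumes "rank_bounded n Omega"
  shows "rel \<alpha> Baire (eval H \<rho> Omega) (enc \<alpha>)"
proof -
  let ?v = "Var ''alpha'' Baire \<cdot> Var ''n'' NatT" and ?m = "Succ \<cdot> Var ''n'' NatT"
  let ?t = "mkJ (Lam ''alpha'' Baire ?v) (Lam ''alpha'' Baire ?m)"
  let ?k = "Lam ''n'' NatT ?t"
  have Omega: "Omega = kappa_c \<cdot> ?k" by (simp add: Omega_def Let_def)
  note b = assms[unfolded Omega]
  have r: "rank Baire \<le> n" using b by simp
  have k: "eval H \<rho> ?k \<in> carr H (NatT \<Rrightarrow> JN)"
    by (rule eval_carr) (use b in \<open>auto simp: env_ok_def\<close>)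
  have kk: "app H (eval H \<rho> ?k) (num H i) = eval H (\<rho>((''n'', NatT) := num H i)) ?t" for i
    by (rule app_eval_Lam) (use b in \<open>auto simp: env_ok_def\<close>)
  have val: "val (app H (eval H \<rho> ?k) (num H i)) \<beta> = \<beta> i" for i \<beta>
    unfolding kk by (subst val_mkJ) (use b r in \<open>auto simp: env_ok_def app_enc\<close>)
  \<comment> \<open>Agreement below \<open>Suc i\<close> includes the index \<open>i\<close>, so
    this is a modulus of evaluation at \<open>i\<close>.\<close>
  have modl: "modl (app H (eval H \<rho> ?k) (num H i)) \<beta> = Suc i" for i \<beta>
    unfolding kk by (subst val_mkJ) (use b r in \<open>auto simp: env_ok_def app_eval_Succ\<close>)
  have "eval H \<rho> Omega \<in> carr H (JN \<Rrightarrow> JN)"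
    by (rule eval_carr[OF type_of_Omega assms]) (simp add: env_ok_def free_vars_Omega)
  moreover have "rel \<alpha> NatT (app H (eval H \<rho> Omega) w) (app H (enc \<alpha>) m)" if wm: "rel \<alpha> NatT w m" for w m
  proof -
    have m: "m = num H (unnum H m)" using rel_carr(2)[OF wm] by (simp add: num_unnum)
    have \<alpha>m: "app H (enc \<alpha>) m = num H (\<alpha> (unnum H m))"
      using app_enc[OF r, of \<alpha> "unnum H m"] unfolding m[symmetric] .
    show ?thesis
      unfolding Omega eval.simps(3) \<alpha>m
      by (rule rel_kappa[OF _ k wm])
        (use b val modl val[of "unnum H m" \<alpha>] m in \<open>auto simp: modulus_of_continuity_def\<close>)
  qed
  ultimately show ?thesis using enc_carr[OF r] by (simp del: rel.simps(1) add: rel.simps(2))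
qed

end

theorem theorem7:
  fixes f :: tm and n :: nat and H :: "'v hierarchy"
  assumes "closed_tm f"
    and "type_of f = Some ((NatT \<Rrightarrow> NatT) \<Rrightarrow> NatT)"
    and "full_hierarchy n H"
    and "rank_bounded n f"
    and "rank_bounded n (modulus_tm f)"
  shows "modulus_of_continuity (functional H (modulus_tm f)) (functional H f)"
proof -
  interpret finite_types n H by unfold_locales (rule assms(3))
  let ?w = "eval H (\<lambda>_. undefined) (Jtm f \<cdot> Omega)"
  have fv: "free_vars f = {}" using assms(1) by (simp add: closed_tm_def)
  have Jf: "type_of (Jtm f) = Some ((JN \<Rrightarrow> JN) \<Rrightarrow> JN)"
    using type_of_Jtm[OF assms(2)] by simp
  have b: "rank_bounded n (Mcomp (Jtm f \<cdot> Omega))" using assms(5) by (simp add: modulus_tm_def)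
  then have bJ: "rank_bounded n (Jtm f)" "rank_bounded n Omega" by simp_all
  \<comment> \<open>\<open>?w\<close> is the same for every \<open>\<alpha>\<close>; only the
    sequence related to \<open>Omega\<close> varies. Closedness of \<open>f\<close> makes the
    condition on environments vacuous.\<close>
  have f: "rel \<alpha> NatT ?w (app H (eval H (\<lambda>_. undefined) f) (enc \<alpha>))" for \<alpha>
    unfolding eval.simps(3)
    by (rule rel_app[OF rel_Jtm[OF assms(2,4) bJ(1)] rel_Omega[OF bJ(2)]]) (simp add: fv)
  have "functional H f \<alpha> = val ?w \<alpha>" for \<alpha>
    using f[of \<alpha>] unfolding functional_def by simp
  moreover have "functional H (modulus_tm f) \<alpha> = modl ?w \<alpha>" for \<alpha>
    unfolding functional_def modulus_tm_def
    by (subst eval_JN_comp(2)[OF _ _ b])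
      (simp_all add: type_of_Omega Jf env_ok_closed free_vars_Jtm free_vars_Omega fv)
  \<comment> \<open>Any single instance of \<open>f\<close> gives this, as the modulus clause of
    \<open>rel\<close> is the same for all \<open>\<alpha>\<close>.\<close>
  moreover have "modulus_of_continuity (modl ?w) (val ?w)"
    using f by simp
  ultimately show ?thesis unfolding modulus_of_continuity_def by simp
qed

end
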